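(* For every integer $n\ge 1$, the antibandwidth of the $n$-cube $Q^{(n)}$ is $$f(Q^{(n)}) = 2^{n-1}-\sum_{m=0}^{n-2}\binom{m}{\lfloor m/2\rfloor}.$$
   Context: The $n$-cube $Q^{(n)}$ is the graph with vertex set $\{0,1\}^n$ in which two vertices are adjacent iff they differ in exactly one coordinate. A numbering of a finite graph $G=(V,E)$ is a bijection $\eta:V\to\{1,2,\dots,|V|\}$. The antibandwidth of $G$ is $f(G)=\max_{\eta}\min_{\{v,w\}\in E}|\eta(v)-\eta(w)|$, the maximum taken over all numberings $\eta$ of $G$. An empty sum equals $0$. *)

theory Defs
  imports Main
begin

text \<open>A finite graph is given by a finite vertex set V and a symmetric adjacency
  predicate adj; edges are the pairs {v,w} with v, w in V and adj v w.\<close>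

definition numbering :: "'a set \<Rightarrow> ('a \<Rightarrow> nat) \<Rightarrow> bool" where
  "numbering V \<eta> \<longleftrightarrow> bij_betw \<eta> V {1..card V}"

definition min_edge_gap :: "'a set \<Rightarrow> ('a \<Rightarrow> 'a \<Rightarrow> bool) \<Rightarrow> ('a \<Rightarrow> nat) \<Rightarrow> int" where
  "min_edge_gap V adj \<eta> =
     Min {\<bar>int (\<eta> v) - int (\<eta> w)\<bar> | v w. v \<in> V \<and> w \<in> V \<and> adj v w}"

definition antibandwidth :: "'a set \<Rightarrow> ('a \<Rightarrow> 'a \<Rightarrow> bool) \<Rightarrow> int" where
  "antibandwidth V adj = Max {min_edge_gap V adj \<eta> | \<eta>. numbering V \<eta>}"

definition cube_vertices :: "nat \<Rightarrow> bool list set" where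
  "cube_vertices n = {xs. length xs = n}"

definition cube_adj :: "bool list \<Rightarrow> bool list \<Rightarrow> bool" where
  "cube_adj xs ys \<longleftrightarrow> length xs = length ys \<and>
     card {i. i < length xs \<and> xs ! i \<noteq> ys ! i} = 1"

end

theory Submission
  imports Defs Complex_Main
begin

text \<open>
  Write \<open>n = d + 1\<close>, \<open>N = 2 ^ d\<close> and \<open>c = (\<Sum>m<d. m choose (m div 2))\<close>, and identify vertices with
  finite sets. By Harper's vertex-isoperimetric theorem, initial segments of the simplicial order
  have the smallest closed neighbourhoods; in the \<open>d\<close>-cube the rank in that order changes by at
  most \<open>c\<close> along an edge, with equality somewhere, so there is a size \<open>s\<close> for which every
  \<open>S\<close> with \<open>s\<close> elements has at least \<open>s + c\<close> elements in its closed neighbourhood.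

  Projecting the \<open>n\<close>-cube onto the \<open>d\<close>-cube and listing all even vertices by the rank of their
  projection before all odd ones gives the gap \<open>N - c\<close>.

  Conversely let a numbering have gaps at least \<open>k\<close>. Orient every edge towards the larger label. If
  every 4-cycle is balanced (two edges each way), the orientation comes from a height function
  \<open>h\<close>. Sweeping heights and labels yields sets \<open>P\<close>, \<open>Q\<close> of the \<open>d\<close>-cube with \<open>Q\<close> outside the
  closed neighbourhood of \<open>P\<close> and \<open>card P + card Q \<ge> k\<close>, where the size of \<open>P\<close> decreases by at
  most one at a time from \<open>N\<close> to \<open>0\<close>; at \<open>card P = s\<close> this gives \<open>k + c \<le> N\<close>. An unbalanced
  4-cycle carries labels that increase three times by at least \<open>k\<close>, so they lie in four short
  intervals. Since every 3-cube around an unbalanced face has a second one, at least \<open>2 n\<close> vertices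
  have such labels, which contradicts \<open>k + c > N\<close> unless \<open>d = 5\<close>; in that case the parities of the
  labels turn out to be periodic with period \<open>20\<close>, which improves every gap to \<open>21\<close>.
\<close>

section \<open>The simplicial order\<close>

text \<open>The simplicial order of Harper's theorem: finite sets of equal size are compared
  lexicographically by their increasingly listed elements.\<close>

definition prec :: "nat set \<Rightarrow> nat set \<Rightarrow> bool" where
  "prec x y \<longleftrightarrow> card x < card y \<or>
     (card x = card y \<and> (\<exists>m\<in>x - y. \<forall>j<m. j \<in> x \<longleftrightarrow> j \<in> y))"

lemma prec_irrefl [simp]: "\<not> prec x x"
  by (auto simp: prec_def)

lemma prec_trans:
  assumes "prec x y" "prec y z"
  shows "prec x z"
proof (cases "card x < card z")
  case False
  with assms have c: "card x = card y" "card y = card z"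
    by (auto simp: prec_def)
  obtain m where m: "m \<in> x - y" "\<forall>j<m. j \<in> x \<longleftrightarrow> j \<in> y"
    using assms(1) c by (auto simp: prec_def)
  obtain l where l: "l \<in> y - z" "\<forall>j<l. j \<in> y \<longleftrightarrow> j \<in> z"
    using assms(2) c by (auto simp: prec_def)
  \<comment> \<open>The deciding elements differ, as \<open>m\<close> is not in \<open>y\<close>
    while \<open>l\<close> is; the smaller one is the first place where \<open>x\<close> and
    \<open>z\<close> differ.\<close>
  have "min m l \<in> x - z \<and> (\<forall>j<min m l. j \<in> x \<longleftrightarrow> j \<in> z)"
    using m l by (cases "m < l"; cases "m = l") (auto simp: min_def)
  then show ?thesis
    using c unfolding prec_def by (metis (no_types, lifting))
qed (simp add: prec_def)

lemma prec_total: "x \<noteq> y \<Longrightarrow> prec x y \<or> prec y x"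
proof -
  assume "x \<noteq> y"
  then have ex: "\<exists>m. m \<in> x \<longleftrightarrow> m \<notin> y" by blast
  define m where "m = (LEAST m. m \<in> x \<longleftrightarrow> m \<notin> y)"
  have m: "m \<in> x \<longleftrightarrow> m \<notin> y"
    unfolding m_def using LeastI_ex[OF ex] .
  have "\<forall>j<m. j \<in> x \<longleftrightarrow> j \<in> y"
    unfolding m_def using not_less_Least by blast
  then show ?thesis
    using m unfolding prec_def by (metis DiffI linorder_neqE_nat)
qed

lemma prec_asym: "prec x y \<Longrightarrow> \<not> prec y x"
  using prec_trans prec_irrefl by blast

lemma prec_insert_iff:
  assumes "finite x" "finite y" "i \<notin> x" "i \<notin> y"
  shows "prec (insert i x) (insert i y) \<longleftrightarrow> prec x y"
proof -
  have "(\<exists>m\<in>insert i x - insert i y. \<forall>j<m. j \<in> insert i x \<longleftrightarrow> j \<in> insert i y)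
      \<longleftrightarrow> (\<exists>m\<in>x - y. \<forall>j<m. j \<in> x \<longleftrightarrow> j \<in> y)"
    using assms by auto
  then show ?thesis
    using assms by (simp add: prec_def)
qed

section \<open>Ranks and initial segments\<close>

definition rank :: "nat set \<Rightarrow> nat set \<Rightarrow> nat" where
  "rank A x = card {z \<in> Pow A. prec z x}"

lemma rank_less:
  assumes "finite A" "x \<in> Pow A" "prec x y"
  shows "rank A x < rank A y"
  unfolding rank_def
proof (rule psubset_card_mono)
  show "finite {z \<in> Pow A. prec z y}"
    using assms by simp
  have "x \<in> {z \<in> Pow A. prec z y}" "x \<notin> {z \<in> Pow A. prec z x}"
    using assms by auto
  moreover have "{z \<in> Pow A. prec z x} \<subseteq> {z \<in> Pow A. prec z y}"
    using assms prec_trans by blast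
  ultimately show "{z \<in> Pow A. prec z x} \<subset> {z \<in> Pow A. prec z y}"
    by blast
qed

lemma rank_inj: "finite A \<Longrightarrow> inj_on (rank A) (Pow A)"
  by (intro inj_onI) (metis prec_total rank_less order_less_irrefl)

lemma rank_bound:
  assumes "finite A" "x \<in> Pow A"
  shows "rank A x < 2 ^ card A"
proof -
  have "x \<in> Pow A" "x \<notin> {z \<in> Pow A. prec z x}"
    using assms by auto
  then have "{z \<in> Pow A. prec z x} \<subset> Pow A"
    by blast
  then have "rank A x < card (Pow A)"
    unfolding rank_def using assms by (intro psubset_card_mono) auto
  then show ?thesis
    using assms by (simp add: card_Pow)
qed

lemma rank_bij: "finite A \<Longrightarrow> bij_betw (rank A) (Pow A) {..<2 ^ card A}"
proof -
  assume A: "finite A"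
  have "rank A ` Pow A \<subseteq> {..<2 ^ card A}"
    using A rank_bound by auto
  moreover have "card (rank A ` Pow A) = 2 ^ card A"
    using A by (simp add: card_image rank_inj card_Pow)
  ultimately have "rank A ` Pow A = {..<2 ^ card A}"
    by (intro card_subset_eq) auto
  then show ?thesis
    using A rank_inj by (auto simp: bij_betw_def)
qed

definition initial :: "nat set \<Rightarrow> nat set set \<Rightarrow> bool" where
  "initial A T \<longleftrightarrow> T \<subseteq> Pow A \<and> (\<forall>x\<in>T. \<forall>z\<in>Pow A. prec z x \<longrightarrow> z \<in> T)"

definition seg :: "nat set \<Rightarrow> nat \<Rightarrow> nat set set" where
  "seg A s = {x \<in> Pow A. rank A x < s}"

lemma initialD: "initial A T \<Longrightarrow> x \<in> T \<Longrightarrow> z \<in> Pow A \<Longrightarrow> prec z x \<Longrightarrow> z \<in> T"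
  by (simp add: initial_def)

lemma initial_subset: "initial A T \<Longrightarrow> T \<subseteq> Pow A"
  by (simp add: initial_def)

lemma initial_finite: "finite A \<Longrightarrow> initial A T \<Longrightarrow> finite T"
  by (meson finite_Pow_iff finite_subset initial_subset)

lemma seg_initial: "finite A \<Longrightarrow> initial A (seg A s)"
  unfolding initial_def seg_def by (auto dest: rank_less)

lemma finite_seg [simp]: "finite A \<Longrightarrow> finite (seg A s)"
  by (simp add: seg_def)

lemma seg_subset: "seg A s \<subseteq> Pow A"
  by (auto simp: seg_def)

lemma card_seg:
  assumes "finite A" "s \<le> 2 ^ card A"
  shows "card (seg A s) = s"
proof -
  have im: "rank A ` Pow A = {..<2 ^ card A}"
    using rank_bij[OF assms(1)] by (simp add: bij_betw_def)
  have "{..<s} \<subseteq> rank A ` seg A s"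
  proof
    fix r assume "r \<in> {..<s}"
    then have "r \<in> rank A ` Pow A"
      using assms(2) im by simp
    with \<open>r \<in> {..<s}\<close> show "r \<in> rank A ` seg A s"
      by (auto simp: seg_def)
  qed
  then have "rank A ` seg A s = {..<s}"
    by (auto simp: seg_def)
  moreover have "inj_on (rank A) (seg A s)"
    by (rule inj_on_subset[OF rank_inj[OF assms(1)] seg_subset])
  ultimately show ?thesis
    by (metis card_image card_lessThan)
qed

lemma initial_chain:
  assumes "initial A S" "initial A T"
  shows "S \<subseteq> T \<or> T \<subseteq> S"
proof (rule ccontr)
  assume "\<not> (S \<subseteq> T \<or> T \<subseteq> S)"
  then obtain x y where xy: "x \<in> S" "x \<notin> T" "y \<in> T" "y \<notin> S"
    by blast
  then have "x \<noteq> y"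
    by blast
  moreover have "x \<in> Pow A" "y \<in> Pow A"
    using xy assms by (auto simp: initial_def)
  ultimately show False
    using prec_total[of x y] initialD[OF assms(1) xy(1)] initialD[OF assms(2) xy(3)] xy by metis
qed

lemma card_le_Pow:
  assumes "finite A" "S \<subseteq> Pow A"
  shows "card S \<le> 2 ^ card A"
  using card_mono[OF _ assms(2)] assms(1) by (simp add: card_Pow)

text \<open>Initial segments form a chain, so their size determines them.\<close>

lemma initial_eq_seg:
  assumes "finite A" "initial A T"
  shows "T = seg A (card T)"
proof -
  have T: "T \<subseteq> Pow A"
    using assms by (simp add: initial_def)
  then have "finite T"
    using assms finite_subset by blast
  moreover have "card (seg A (card T)) = card T"
    by (rule card_seg[OF assms(1) card_le_Pow[OF assms(1) T]])
  moreover have "T \<subseteq> seg A (card T) \<or> seg A (card T) \<subseteq> T"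
    by (rule initial_chain[OF assms(2) seg_initial[OF assms(1)]])
  ultimately show ?thesis
    by (metis assms(1) card_subset_eq finite_seg)
qed

text \<open>One of the two sets contains the other. This makes unions of initial segments as small
  as possible in the induction for Harper's theorem.\<close>

lemma card_initial_Un:
  assumes "finite A" "initial A S" "initial A T"
  shows "card (S \<union> T) = max (card S) (card T)"
proof -
  have "finite S" "finite T"
    using assms initial_finite by auto
  with initial_chain[OF assms(2,3)] show ?thesis
    by (auto simp: Un_absorb1 Un_absorb2 max.absorb1 max.absorb2 card_mono)
qed

section \<open>Closed neighbourhoods in the cube of subsets\<close>

definition toggle :: "nat \<Rightarrow> nat set \<Rightarrow> nat set" where
  "toggle i x = (if i \<in> x then x - {i} else insert i x)"

definition nb :: "nat set \<Rightarrow> nat set set \<Rightarrow> nat set set" where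
  "nb A S = S \<union> {toggle i x |i x. i \<in> A \<and> x \<in> S}"

lemma toggle_toggle [simp]: "toggle i (toggle i x) = x"
  by (auto simp: toggle_def)

lemma nb_subset: "S \<subseteq> Pow A \<Longrightarrow> nb A S \<subseteq> Pow A"
  by (auto simp: nb_def toggle_def split: if_splits)

lemma finite_nb: "finite A \<Longrightarrow> S \<subseteq> Pow A \<Longrightarrow> finite (nb A S)"
  by (meson finite_Pow_iff finite_subset nb_subset)

lemma nb_Un: "nb A (S \<union> T) = nb A S \<union> nb A T"
  by (auto simp: nb_def)

lemma nb_addI: "x \<in> S \<Longrightarrow> i \<in> A \<Longrightarrow> i \<notin> x \<Longrightarrow> insert i x \<in> nb A S"
  by (auto simp: nb_def toggle_def)

lemma nb_removeI: "x - {i} \<in> S \<Longrightarrow> i \<in> A \<Longrightarrow> i \<in> x \<Longrightarrow> x \<in> nb A S"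
  using nb_addI[of "x - {i}" S i A] by (simp add: insert_absorb)

text \<open>The main case is \<open>w = insert i t\<close> with \<open>t\<close> in \<open>T\<close>
  and \<open>z\<close> before \<open>w\<close>: removing the largest element \<open>M\<close> of
  \<open>z\<close> gives \<open>t\<close> or a set preceding it, so \<open>z\<close> is a neighbour
  of a member of \<open>T\<close>.\<close>

lemma initial_nb:
  assumes A: "finite A" and T: "initial A T"
  shows "initial A (nb A T)"
proof -
  have sub: "T \<subseteq> Pow A" and down: "\<And>x z. x \<in> T \<Longrightarrow> z \<in> Pow A \<Longrightarrow> prec z x \<Longrightarrow> z \<in> T"
    using T by (auto simp: initial_def)
  have "z \<in> nb A T" if w: "w \<in> nb A T" and z: "z \<in> Pow A" "prec z w" for w z
  proof (cases "w \<in> T")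
    case True
    then show ?thesis
      using z down by (auto simp: nb_def)
  next
    case False
    then obtain i t where it: "i \<in> A" "t \<in> T" "w = toggle i t"
      using w by (auto simp: nb_def)
    have fin: "finite t" "finite z"
      using it sub z A by (auto intro: finite_subset)
    have "i \<notin> t"
    proof
      assume i: "i \<in> t"
      then have "card w < card t"
        using it fin card_Diff1_less[of t i] by (simp add: toggle_def del: card_Diff_insert)
      then show False
        using False it down[of t w] sub i by (auto simp: prec_def toggle_def)
    qed
    then have w_eq: "w = insert i t" and cw: "card w = Suc (card t)"
      using it fin by (auto simp: toggle_def)
    show ?thesis
    proof (cases "z = {}")
      case True
      have "z = t \<or> prec z t"
        using True fin by (cases "t = {}") (auto simp: prec_def card_gt_0_iff)
      then show ?thesis
        using it z down by (auto simp: nb_def)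
    next
      case False
      define M where "M = Max z"
      have M: "M \<in> z" "\<And>j. j \<in> z \<Longrightarrow> j \<le> M"
        using False fin by (auto simp: M_def)
      have cz: "Suc (card (z - {M})) = card z"
        using M fin by (metis card_Suc_Diff1)
      have "z - {M} = t \<or> prec (z - {M}) t"
      proof (cases "card z = Suc (card t)")
        case False
        then have "card z < Suc (card t)"
          using z cw by (auto simp: prec_def)
        then show ?thesis
          using cz by (auto simp: prec_def)
      next
        case True
        then obtain m where m: "m \<in> z" "m \<notin> t" "m \<noteq> i" "\<forall>j<m. j \<in> z \<longleftrightarrow> j = i \<or> j \<in> t"
          using z cw by (auto simp: prec_def w_eq)
        have c: "card (z - {M}) = card t"
          using True cz by simp
        \<comment> \<open>If \<open>i < m\<close>, then \<open>i\<close> lies in \<open>z\<close>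
          and decides between \<open>z - {M}\<close> and \<open>t\<close>. If \<open>m < M\<close>,
          then \<open>m\<close> still decides. If \<open>m = M < i\<close>, the rest of
          \<open>z\<close> lies in \<open>t\<close> and has the same size, so it equals
          \<open>t\<close>.\<close>
        consider "i < m" | "i > m" "m < M" | "i > m" "m = M"
          using m M by fastforce
        then show ?thesis
        proof cases
          case 1
          then have "i \<in> z - {M} - t" "\<forall>j<i. j \<in> z - {M} \<longleftrightarrow> j \<in> t"
            using m M(2)[OF m(1)] \<open>i \<notin> t\<close> by auto
          then show ?thesis
            using c by (auto simp: prec_def)
        next
          case 2
          then have "m \<in> z - {M} - t" "\<forall>j<m. j \<in> z - {M} \<longleftrightarrow> j \<in> t"
            using m by auto
          then show ?thesis
            using c unfolding prec_def by blast
        next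
          case 3
          then have "z - {M} \<subseteq> t"
            using m M(2) by (auto simp: less_le)
          then show ?thesis
            using c fin by (metis card_subset_eq)
        qed
      qed
      then have "z - {M} \<in> T"
        using it down[of t "z - {M}"] z by blast
      then show ?thesis
        using nb_removeI[of z M T A] M z by auto
    qed
  qed
  then show ?thesis
    using nb_subset[OF sub] by (auto simp: initial_def)
qed

section \<open>Compressions and Harper's theorem\<close>

definition lower_section :: "nat \<Rightarrow> nat set set \<Rightarrow> nat set set" where
  "lower_section i S = {x \<in> S. i \<notin> x}"

definition upper_section :: "nat \<Rightarrow> nat set set \<Rightarrow> nat set set" where
  "upper_section i S = {x. i \<notin> x \<and> insert i x \<in> S}"

lemma section_decomp: "S = lower_section i S \<union> insert i ` upper_section i S"
proof (intro set_eqI iffI)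
  fix x assume x: "x \<in> S"
  show "x \<in> lower_section i S \<union> insert i ` upper_section i S"
  proof (cases "i \<in> x")
    case True
    then have "insert i (x - {i}) = x"
      by auto
    moreover from this have "x - {i} \<in> upper_section i S"
      using x by (simp add: upper_section_def)
    ultimately show ?thesis
      by (metis UnI2 imageI)
  qed (use x in \<open>simp add: lower_section_def\<close>)
qed (auto simp: lower_section_def upper_section_def)

lemma inj_on_insert_upper: "inj_on (insert i) (upper_section i S)"
  by (auto simp: inj_on_def upper_section_def)

lemma finite_sections:
  assumes "finite S"
  shows "finite (lower_section i S)" "finite (upper_section i S)"
proof -
  show "finite (lower_section i S)"
    using assms by (simp add: lower_section_def)
  have "insert i ` upper_section i S \<subseteq> S"
    by (auto simp: upper_section_def)
  then have "finite (insert i ` upper_section i S)"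
    using assms finite_subset by auto
  then show "finite (upper_section i S)"
    using inj_on_insert_upper finite_imageD by auto
qed

lemma sum_sections:
  fixes f :: "nat set \<Rightarrow> nat"
  assumes "finite S"
  shows "sum f S = sum f (lower_section i S) + sum (\<lambda>x. f (insert i x)) (upper_section i S)"
proof -
  have "lower_section i S \<inter> insert i ` upper_section i S = {}"
    by (auto simp: lower_section_def)
  then have "sum f (lower_section i S \<union> insert i ` upper_section i S)
      = sum f (lower_section i S) + sum f (insert i ` upper_section i S)"
    using finite_sections[OF assms] by (intro sum.union_disjoint) auto
  also have "sum f (insert i ` upper_section i S) = sum (\<lambda>x. f (insert i x)) (upper_section i S)"
    using sum.reindex[OF inj_on_insert_upper, of f i S] by (simp add: comp_def)
  finally show ?thesis
    using section_decomp[of S i] by simp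
qed

lemma card_sections:
  "finite S \<Longrightarrow> card S = card (lower_section i S) + card (upper_section i S)"
  using sum_sections[of S "\<lambda>_. 1" i] by simp

lemma sections_subset:
  assumes "S \<subseteq> Pow A"
  shows "lower_section i S \<subseteq> Pow (A - {i})" "upper_section i S \<subseteq> Pow (A - {i})"
  using assms by (auto simp: lower_section_def upper_section_def)

text \<open>A vertex without \<open>i\<close> is reached inside its own half of the cube or along
  direction \<open>i\<close>, where the other half contributes its section unchanged.\<close>

lemma lower_section_nb:
  assumes "i \<in> A"
  shows "lower_section i (nb A S) = nb (A - {i}) (lower_section i S) \<union> upper_section i S"
proof (intro set_eqI iffI)
  fix x assume x: "x \<in> lower_section i (nb A S)"
  then have i: "i \<notin> x" and "x \<in> S \<or> (\<exists>j y. j \<in> A \<and> y \<in> S \<and> x = toggle j y)"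
    by (auto simp: lower_section_def nb_def)
  then consider "x \<in> S" | j y where "j \<in> A" "y \<in> S" "x = toggle j y"
    by blast
  then show "x \<in> nb (A - {i}) (lower_section i S) \<union> upper_section i S"
  proof cases
    case 1
    then show ?thesis
      using i by (simp add: nb_def lower_section_def)
  next
    case 2
    show ?thesis
    proof (cases "j = i")
      case True
      then have "i \<in> y" "insert i x = y"
        using 2 i by (auto simp: toggle_def split: if_splits)
      then show ?thesis
        using 2 i by (simp add: upper_section_def)
    next
      case False
      then have "i \<notin> y"
        using 2 i by (auto simp: toggle_def split: if_splits)
      then show ?thesis
        using 2 False by (auto simp: nb_def lower_section_def)
    qed
  qed
next
  fix x assume "x \<in> nb (A - {i}) (lower_section i S) \<union> upper_section i S"
  then consider "x \<in> lower_section i S"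
    | j y where "j \<in> A" "j \<noteq> i" "y \<in> lower_section i S" "x = toggle j y"
    | "x \<in> upper_section i S"
    by (auto simp: nb_def)
  then show "x \<in> lower_section i (nb A S)"
  proof cases
    case 1
    then show ?thesis
      by (simp add: lower_section_def nb_def)
  next
    case 2
    then show ?thesis
      by (auto simp: lower_section_def nb_def toggle_def)
  next
    case 3
    then have "toggle i (insert i x) = x" "i \<notin> x" "insert i x \<in> S"
      by (auto simp: upper_section_def toggle_def)
    then show ?thesis
      using assms by (force simp: lower_section_def nb_def)
  qed
qed

lemma upper_section_nb:
  assumes "i \<in> A"
  shows "upper_section i (nb A S) = nb (A - {i}) (upper_section i S) \<union> lower_section i S"
proof (intro set_eqI iffI)
  fix x assume x: "x \<in> upper_section i (nb A S)"
  then have i: "i \<notin> x"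
    and "insert i x \<in> S \<or> (\<exists>j y. j \<in> A \<and> y \<in> S \<and> insert i x = toggle j y)"
    by (auto simp: upper_section_def nb_def)
  then consider "insert i x \<in> S" | j y where "j \<in> A" "y \<in> S" "insert i x = toggle j y"
    by blast
  then show "x \<in> nb (A - {i}) (upper_section i S) \<union> lower_section i S"
  proof cases
    case 1
    then show ?thesis
      using i by (simp add: nb_def upper_section_def)
  next
    case 2
    show ?thesis
    proof (cases "j = i")
      case True
      then have "x = y"
        using 2 i by (auto simp: toggle_def split: if_splits)
      then show ?thesis
        using 2 i by (simp add: lower_section_def)
    next
      case False
      then have y: "i \<in> y"
        using 2 i by (auto simp: toggle_def split: if_splits)
      have "x = insert i x - {i}"
        using i by simp
      also have "\<dots> = toggle j (y - {i})"
        using 2 False by (auto simp: toggle_def)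
      finally have "x = toggle j (y - {i})" .
      moreover have "y - {i} \<in> upper_section i S"
        using 2 y by (simp add: upper_section_def insert_absorb)
      ultimately show ?thesis
        using 2 False by (auto simp: nb_def)
    qed
  qed
next
  fix x assume "x \<in> nb (A - {i}) (upper_section i S) \<union> lower_section i S"
  then consider "x \<in> upper_section i S"
    | j y where "j \<in> A" "j \<noteq> i" "y \<in> upper_section i S" "x = toggle j y"
    | "x \<in> lower_section i S"
    by (auto simp: nb_def)
  then show "x \<in> upper_section i (nb A S)"
  proof cases
    case 1
    then show ?thesis
      by (simp add: upper_section_def nb_def)
  next
    case 2
    then have "insert i x = toggle j (insert i y)" "i \<notin> x" "insert i y \<in> S"
      by (auto simp: upper_section_def toggle_def)
    then show ?thesis
      using 2 by (auto simp: upper_section_def nb_def)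
  next
    case 3
    then have "toggle i x = insert i x" "i \<notin> x" "x \<in> S"
      by (auto simp: lower_section_def toggle_def)
    then show ?thesis
      using assms by (force simp: upper_section_def nb_def)
  qed
qed

lemma card_nb_sections:
  assumes "finite A" "S \<subseteq> Pow A" "i \<in> A"
  shows "card (nb A S) = card (nb (A - {i}) (lower_section i S) \<union> upper_section i S)
      + card (nb (A - {i}) (upper_section i S) \<union> lower_section i S)"
  using card_sections[OF finite_nb[OF assms(1,2)], of i]
  by (simp add: lower_section_nb[OF assms(3)] upper_section_nb[OF assms(3)])

text \<open>Both halves become initial segments of a smaller cube, where Harper's theorem is
  available by induction on the dimension.\<close>

definition compress :: "nat set \<Rightarrow> nat \<Rightarrow> nat set set \<Rightarrow> nat set set" where
  "compress A i S = seg (A - {i}) (card (lower_section i S))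
     \<union> insert i ` seg (A - {i}) (card (upper_section i S))"

lemma seg_notin: "x \<in> seg (A - {i}) s \<Longrightarrow> i \<notin> x"
  using seg_subset by fastforce

lemma sections_compress:
  "lower_section i (compress A i S) = seg (A - {i}) (card (lower_section i S))"
  "upper_section i (compress A i S) = seg (A - {i}) (card (upper_section i S))"
proof -
  show "lower_section i (compress A i S) = seg (A - {i}) (card (lower_section i S))"
    by (auto simp: lower_section_def compress_def dest: seg_notin)
  show "upper_section i (compress A i S) = seg (A - {i}) (card (upper_section i S))"
  proof (intro set_eqI iffI)
    fix x assume "x \<in> upper_section i (compress A i S)"
    then have i: "i \<notin> x" "insert i x \<in> compress A i S"
      by (auto simp: upper_section_def)
    then obtain y where "y \<in> seg (A - {i}) (card (upper_section i S))" "insert i x = insert i y"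
      by (auto simp: compress_def dest: seg_notin)
    then show "x \<in> seg (A - {i}) (card (upper_section i S))"
      using i seg_notin by (metis insert_ident)
  next
    fix x assume "x \<in> seg (A - {i}) (card (upper_section i S))"
    then show "x \<in> upper_section i (compress A i S)"
      by (auto simp: upper_section_def compress_def dest: seg_notin)
  qed
qed

lemma compress_subset: "i \<in> A \<Longrightarrow> compress A i S \<subseteq> Pow A"
  using seg_subset[of "A - {i}"] by (fastforce simp: compress_def)

lemma card_seg_sections:
  assumes "finite A" "S \<subseteq> Pow A"
  shows "card (seg (A - {i}) (card (lower_section i S))) = card (lower_section i S)"
    "card (seg (A - {i}) (card (upper_section i S))) = card (upper_section i S)"
  using assms sections_subset[OF assms(2), of i] by (auto intro!: card_seg card_le_Pow)

lemma card_compress: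
  assumes "finite A" "S \<subseteq> Pow A" "i \<in> A"
  shows "card (compress A i S) = card S"
proof -
  have "finite S" "finite (compress A i S)"
    using assms compress_subset by (meson finite_Pow_iff finite_subset)+
  then show ?thesis
    using card_sections[of S i] card_sections[of "compress A i S" i] card_seg_sections[OF assms(1,2), of i]
    by (simp add: sections_compress)
qed

lemma sum_less_of_separated:
  fixes f :: "'a \<Rightarrow> nat"
  assumes "finite X" "finite Y" "card X = card Y" "X \<noteq> {}"
    and "\<And>x y. x \<in> X \<Longrightarrow> y \<in> Y \<Longrightarrow> f x < f y"
  shows "sum f X < sum f Y"
proof -
  obtain g where g: "bij_betw g X Y"
    using assms finite_same_card_bij by blast
  have "sum f X < sum (\<lambda>x. f (g x)) X"
    using assms g by (intro sum_strict_mono) (auto dest: bij_betwE)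
  also have "\<dots> = sum f Y"
    using g by (rule sum.reindex_bij_betw)
  finally show ?thesis .
qed

text \<open>Every element of the segment outside \<open>U\<close> precedes every element of
  \<open>U\<close> outside the segment, and the two differences have equal size.\<close>

lemma sum_seg_less:
  fixes f :: "nat set \<Rightarrow> nat"
  assumes B: "finite B" and U: "U \<subseteq> Pow B" and ne: "U \<noteq> seg B (card U)"
    and f: "\<And>x y. x \<in> Pow B \<Longrightarrow> y \<in> Pow B \<Longrightarrow> prec x y \<Longrightarrow> f x < f y"
  shows "sum f (seg B (card U)) < sum f U"
proof -
  define T where "T = seg B (card U)"
  have fin: "finite U" "finite T"
    using B U finite_subset by (auto simp: T_def)
  have cT: "card T = card U"
    using card_seg[OF B card_le_Pow[OF B U]] by (simp add: T_def)
  have c: "card (T - U) = card (U - T)"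
    using fin cT by (intro le_antisym card_le_sym_Diff) auto
  have "T - U \<noteq> {}"
  proof
    assume "T - U = {}"
    then show False
      using fin cT ne card_subset_eq[of U T] by (auto simp: T_def)
  qed
  moreover have "f x < f y" if "x \<in> T - U" "y \<in> U - T" for x y
  proof (rule f)
    show x: "x \<in> Pow B" and y: "y \<in> Pow B"
      using that U seg_subset[of B] unfolding T_def by auto
    have "\<not> prec y x"
      using that initialD[OF seg_initial[OF B] _ y] by (auto simp: T_def)
    moreover have "x \<noteq> y"
      using that by auto
    ultimately show "prec x y"
      using prec_total by auto
  qed
  ultimately have "sum f (T - U) < sum f (U - T)"
    using fin c by (intro sum_less_of_separated) auto
  moreover have "sum f T = sum f (T - U) + sum f (T \<inter> U)" "sum f U = sum f (U - T) + sum f (T \<inter> U)"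
    using fin by (metis sum.Int_Diff add.commute, metis sum.Int_Diff add.commute inf_commute)
  ultimately show ?thesis
    by (simp add: T_def)
qed

text \<open>The decreasing measure for the induction over compressions. On the upper half the weight
  is the rank of \<open>insert i x\<close>, which still increases with \<open>x\<close> because a
  common element does not affect \<open>prec\<close>.\<close>

lemma sum_rank_compress_less:
  assumes A: "finite A" and S: "S \<subseteq> Pow A" and i: "i \<in> A" and ne: "compress A i S \<noteq> S"
  shows "sum (rank A) (compress A i S) < sum (rank A) S"
proof -
  let ?B = "A - {i}" and ?L = "lower_section i S" and ?U = "upper_section i S"
  have fin: "finite S" "finite (compress A i S)"
    using assms compress_subset by (meson finite_Pow_iff finite_subset)+
  have B: "finite ?B"
    using A by simp
  have lo: "sum (rank A) (seg ?B (card ?L)) < sum (rank A) ?L" if "?L \<noteq> seg ?B (card ?L)"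
    using rank_less[OF A] by (intro sum_seg_less[OF B sections_subset(1)[OF S] that]) auto
  have up: "sum (\<lambda>x. rank A (insert i x)) (seg ?B (card ?U)) < sum (\<lambda>x. rank A (insert i x)) ?U"
    if "?U \<noteq> seg ?B (card ?U)"
  proof (rule sum_seg_less[OF B _ that])
    show "?U \<subseteq> Pow ?B"
      by (rule sections_subset[OF S])
    fix x y assume xy: "x \<in> Pow ?B" "y \<in> Pow ?B" "prec x y"
    then have "finite x" "finite y"
      using B by (meson PowD finite_subset)+
    then have "prec (insert i x) (insert i y)"
      using xy prec_insert_iff[of x y i] by auto
    then show "rank A (insert i x) < rank A (insert i y)"
      using xy i by (intro rank_less[OF A]) auto
  qed
  have "?L \<noteq> seg ?B (card ?L) \<or> ?U \<noteq> seg ?B (card ?U)"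
    using ne section_decomp[of S i] unfolding compress_def by auto
  then have "sum (rank A) (seg ?B (card ?L)) + sum (\<lambda>x. rank A (insert i x)) (seg ?B (card ?U))
      < sum (rank A) ?L + sum (\<lambda>x. rank A (insert i x)) ?U"
    using lo up by (cases "?L = seg ?B (card ?L)"; cases "?U = seg ?B (card ?U)") fastforce+
  then show ?thesis
    using sum_sections[OF fin(1), of "rank A" i] sum_sections[OF fin(2), of "rank A" i]
    by (simp add: sections_compress)
qed

text \<open>If \<open>x\<close> and \<open>y\<close> agreed at a coordinate \<open>i\<close>, they
  would lie in the same half; its section is an initial segment because \<open>S\<close> is
  compressed, so \<open>x\<close> would belong to \<open>S\<close> along with
  \<open>y\<close>.\<close>

lemma compressed_bad_pair:
  assumes A: "finite A" and comp: "\<And>i. i \<in> A \<Longrightarrow> compress A i S = S"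
    and x: "x \<in> Pow A" "x \<notin> S" and y: "y \<in> Pow A" "y \<in> S" and xy: "prec x y"
  shows "y = A - x"
proof -
  have fin: "finite x" "finite y"
    using A x y by (meson PowD finite_subset)+
  have "i \<in> x \<longleftrightarrow> i \<notin> y" if i: "i \<in> A" for i
  proof -
    have B: "finite (A - {i})"
      using A by simp
    have "\<not> (i \<in> x \<and> i \<in> y)"
    proof
      assume ixy: "i \<in> x \<and> i \<in> y"
      then have ins: "insert i (x - {i}) = x" "insert i (y - {i}) = y"
        by auto
      have "prec (x - {i}) (y - {i})"
        using prec_insert_iff[of "x - {i}" "y - {i}" i] fin xy ins by simp
      moreover have "y - {i} \<in> upper_section i S"
        using ins y by (simp add: upper_section_def)
      moreover have "initial (A - {i}) (upper_section i S)"
        using sections_compress(2)[of i A S] comp[OF i] seg_initial[OF B] by metis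
      moreover have "x - {i} \<in> Pow (A - {i})"
        using x by auto
      ultimately have "x - {i} \<in> upper_section i S"
        using initialD by blast
      then show False
        using x ins by (simp add: upper_section_def)
    qed
    moreover have "\<not> (i \<notin> x \<and> i \<notin> y)"
    proof
      assume ixy: "i \<notin> x \<and> i \<notin> y"
      then have "y \<in> lower_section i S"
        using y by (simp add: lower_section_def)
      moreover have "initial (A - {i}) (lower_section i S)"
        using sections_compress(1)[of i A S] comp[OF i] seg_initial[OF B] by metis
      moreover have "x \<in> Pow (A - {i})"
        using x ixy by auto
      ultimately have "x \<in> lower_section i S"
        using initialD xy by blast
      then show False
        using x by (simp add: lower_section_def)
    qed
    ultimately show ?thesis
      by blast
  qed
  then show ?thesis
    using x y by auto
qed

lemma prec_swap:
  assumes "finite x" "j \<in> x" "M \<notin> x" "j < M"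
  shows "prec x (insert M (x - {j}))" "card (insert M (x - {j})) = card x"
proof -
  have "Suc (card (x - {j})) = card x"
    using assms by (metis card_Suc_Diff1)
  then show c: "card (insert M (x - {j})) = card x"
    using assms by simp
  show "prec x (insert M (x - {j}))"
    unfolding prec_def
  proof (intro disjI2 conjI bexI[of _ j])
    show "card x = card (insert M (x - {j}))"
      using c by simp
  qed (use assms in auto)
qed

text \<open>A compressed set that is not an initial segment arises from an initial segment by replacing
  its last element \<open>x\<close> by the successor of \<open>x\<close>, which is \<open>A - x\<close>.\<close>

lemma nb_adjacent_complement:
  assumes A: "finite A" and x: "x \<in> Pow A" and xy: "prec x (A - x)"
    and adj: "\<And>z. z \<in> Pow A \<Longrightarrow> \<not> (prec x z \<and> prec z (A - x))"
  defines "U \<equiv> {z \<in> Pow A. prec z x}"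
  shows "card (nb A (insert x U)) \<le> card (nb A (insert (A - x) U))"
proof -
  have fin: "finite x"
    using A x by (meson PowD finite_subset)
  have U: "U \<subseteq> Pow A"
    by (auto simp: U_def)
  have finnb: "finite (nb A (insert x U))" "finite (nb A (insert (A - x) U))"
    using A x U by (auto intro!: finite_nb)
  have "A \<noteq> {}"
    using xy x by auto
  define M where "M = Max A"
  have M: "M \<in> A" "\<And>j. j \<in> A \<Longrightarrow> j \<le> M"
    using A \<open>A \<noteq> {}\<close> by (auto simp: M_def)
  \<comment> \<open>For empty \<open>x\<close> both families are singletons. If \<open>M\<close> is
    in \<open>x\<close>, then \<open>x\<close> adds no neighbours beyond those of \<open>U\<close>.
    Otherwise moving elements of \<open>x\<close> up to \<open>M\<close> forces the cube to be
    two-dimensional.\<close>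
  consider "x = {}" | "x \<noteq> {}" "M \<in> x" | "x \<noteq> {}" "M \<notin> x"
    by blast
  then show ?thesis
  proof cases
    case 1
    then have "U = {}"
      using A by (auto simp: U_def prec_def dest: finite_subset)
    have "card (nb A {w}) = Suc (card A)" if "w \<in> Pow A" for w
    proof -
      have "nb A {w} = insert w ((\<lambda>i. toggle i w) ` A)"
        by (auto simp: nb_def)
      moreover have "w \<notin> (\<lambda>i. toggle i w) ` A"
        by (auto simp: toggle_def split: if_splits)
      moreover have "inj_on (\<lambda>i. toggle i w) A"
        by (auto simp: inj_on_def toggle_def split: if_splits)
      ultimately show ?thesis
        using A by (simp add: card_image)
    qed
    then show ?thesis
      using \<open>U = {}\<close> x by simp
  next
    case 2
    have small: "x - {i} \<in> U" if "i \<in> x" for i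
      using that x fin card_Diff1_less[of x i] by (auto simp: U_def prec_def simp del: card_Diff_insert)
    have "nb A {x} \<subseteq> nb A U"
    proof
      fix w assume "w \<in> nb A {x}"
      then consider "w = x" | i where "i \<in> x" "w = x - {i}" | i where "i \<in> A" "i \<notin> x" "w = insert i x"
        by (auto simp: nb_def toggle_def split: if_splits)
      then show "w \<in> nb A U"
      proof cases
        case 1
        then show ?thesis
          using nb_removeI[of x M U A] small 2 M by auto
      next
        case (2 i)
        then show ?thesis
          using small by (auto simp: nb_def)
      next
        case (3 i)
        have "i < M"
          using 3 M 2 by (metis le_neq_implies_less)
        have "card (insert i x - {M}) = card x"
          using 3 2 fin by (simp add: card_Diff_singleton)
        moreover have "i \<in> insert i x - {M} - x" "\<forall>j<i. j \<in> insert i x - {M} \<longleftrightarrow> j \<in> x"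
          using 3 \<open>i < M\<close> by auto
        ultimately have "prec (insert i x - {M}) x"
          unfolding prec_def by blast
        then have "w - {M} \<in> U"
          using 3 x by (auto simp: U_def)
        then show ?thesis
          using nb_removeI[of w M U A] 2 3 M by auto
      qed
    qed
    then have "nb A (insert x U) \<subseteq> nb A (insert (A - x) U)"
      using nb_Un[of A "{x}" U] nb_Un[of A "{A - x}" U] by auto
    then show ?thesis
      using finnb card_mono by auto
  next
    case 3
    have card_le: "card x \<le> card (A - x)"
      using xy by (auto simp: prec_def)
    \<comment> \<open>Exchanging \<open>j\<close> for \<open>M\<close> leads to a set after
      \<open>x\<close>, which cannot come before \<open>A - x\<close> because nothing lies strictly
      between.\<close>
    have swap: "insert M (x - {j}) = A - x \<or> prec (A - x) (insert M (x - {j}))"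
      and swap_card: "card (insert M (x - {j})) = card x" if "j \<in> x" for j
    proof -
      have "j < M"
        using that M x 3 by (metis PowD le_neq_implies_less subsetD)
      then have p: "prec x (insert M (x - {j}))" "card (insert M (x - {j})) = card x"
        using prec_swap[OF fin that] 3 by auto
      moreover have "insert M (x - {j}) \<in> Pow A"
        using M x by auto
      ultimately show "insert M (x - {j}) = A - x \<or> prec (A - x) (insert M (x - {j}))"
        using adj prec_total by metis
      show "card (insert M (x - {j})) = card x"
        by fact
    qed
    obtain j0 where "j0 \<in> x"
      using 3 by blast
    have "card (A - x) \<le> card x"
      using swap[OF \<open>j0 \<in> x\<close>] swap_card[OF \<open>j0 \<in> x\<close>] by (auto simp: prec_def)
    then have c: "card (A - x) = card x"
      using card_le by simp
    obtain m where m: "m \<in> x" "\<And>j. j < m \<Longrightarrow> j \<in> x \<longleftrightarrow> j \<in> A - x"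
      using xy c by (auto simp: prec_def)
    have mmin: "m \<le> j" if "j \<in> A" for j
      using m(2)[of j] that x by (cases "j < m") auto
    \<comment> \<open>Otherwise \<open>m\<close> survives the exchange of \<open>j\<close> for
      \<open>M\<close> and, being the least element of \<open>A\<close>, puts the result before
      \<open>A - x\<close>.\<close>
    have "j = m" if j: "j \<in> x" for j
    proof (rule ccontr)
      assume "j \<noteq> m"
      let ?z = "insert M (x - {j})"
      have "m \<in> ?z - (A - x)" "\<forall>l<m. l \<in> ?z \<longleftrightarrow> l \<in> A - x"
        using m \<open>j \<noteq> m\<close> mmin M x by force+
      moreover have "card ?z = card (A - x)"
        using swap_card[OF j] c by simp
      ultimately have "prec ?z (A - x)" "?z \<noteq> A - x"
        unfolding prec_def by blast+
      then show False
        using swap[OF j] prec_asym by blast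
    qed
    then have xm: "x = {m}"
      using m by blast
    then have "card (A - x) = Suc 0"
      using c by simp
    moreover have "M \<in> A - x"
      using M 3 by simp
    ultimately have AM: "A - x = {M}"
      by (metis card_1_singletonE One_nat_def singletonD)
    then have A2: "A = {m, M}"
      using xm x by auto
    \<comment> \<open>From here on the neighbourhood on the right is seen to be the whole
      square.\<close>
    have "{} \<in> U"
      using xm by (auto simp: U_def prec_def)
    then have "insert i {} \<in> nb A U" if "i \<in> A" for i
      using that nb_addI by blast
    moreover have "insert m {M} \<in> nb A {{M}}"
      using nb_addI[of "{M}" "{{M}}" m A] A2 3 xm by auto
    ultimately have "Pow A \<subseteq> nb A (insert (A - x) U)"
      using nb_Un[of A "{A - x}" U] A2 AM \<open>{} \<in> U\<close> by (auto simp: Pow_insert nb_def)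
    moreover have "nb A (insert x U) \<subseteq> Pow A"
      using x U by (intro nb_subset) auto
    ultimately show ?thesis
      using finnb by (intro card_mono) auto
  qed
qed

lemma card_nb_seg_compressed:
  assumes A: "finite A" and S: "S \<subseteq> Pow A" and comp: "\<And>i. i \<in> A \<Longrightarrow> compress A i S = S"
  shows "card (nb A (seg A (card S))) \<le> card (nb A S)"
proof (cases "initial A S")
  case True
  then show ?thesis
    using initial_eq_seg[OF A] by simp
next
  case False
  then obtain x y where x: "x \<in> Pow A" "x \<notin> S" and y: "y \<in> S" and xy: "prec x y"
    using S by (auto simp: initial_def)
  have bad: "v = A - u" if "u \<in> Pow A" "u \<notin> S" "v \<in> S" "prec u v" for u v
    using compressed_bad_pair[OF A comp that(1,2) _ that(3,4)] that(3) S by auto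
  have y_eq: "y = A - x"
    by (rule bad[OF x y xy])
  \<comment> \<open>A set \<open>z\<close> in between would form a bad pair with \<open>x\<close> if
    it is in \<open>S\<close> and with \<open>y\<close> if it is not, but bad pairs are
    complementary.\<close>
  have adj: "\<not> (prec x z \<and> prec z (A - x))" if z: "z \<in> Pow A" for z
  proof
    assume p: "prec x z \<and> prec z (A - x)"
    show False
    proof (cases "z \<in> S")
      case True
      then show False
        using bad[OF x True] p by auto
    next
      case False
      then have "A - x = A - z"
        using bad[OF z False y] p y_eq by auto
      then have "x = z"
        using x z by auto
      then show False
        using p by auto
    qed
  qed
  define U where "U = {z \<in> Pow A. prec z x}"
  have "U \<subseteq> S"
  proof
    fix z assume z: "z \<in> U"
    show "z \<in> S"
    proof (rule ccontr)
      assume "z \<notin> S"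
      moreover have "prec z y"
        using z xy prec_trans by (auto simp: U_def)
      ultimately have "y = A - z"
        using bad z y by (auto simp: U_def)
      then have "z = x"
        using y_eq x z by (auto simp: U_def)
      then show False
        using z by (simp add: U_def)
    qed
  qed
  moreover have "z = y \<or> z \<in> U" if z: "z \<in> S" for z
  proof (cases "prec x z")
    case True
    then show ?thesis
      using bad[OF x z] y_eq by simp
  next
    case False
    then have "prec z x"
      using prec_total[of x z] x z by auto
    then show ?thesis
      using z S by (auto simp: U_def)
  qed
  ultimately have S_eq: "S = insert y U"
    using y by auto
  have finU: "finite U"
    using A by (simp add: U_def)
  have "initial A (insert x U)"
    using x prec_trans unfolding initial_def U_def by auto
  moreover have "card (insert x U) = card S"
  proof -
    have "x \<notin> U" "y \<notin> U"
      using prec_asym xy by (auto simp: U_def)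
    then show ?thesis
      using finU S_eq by simp
  qed
  ultimately have "seg A (card S) = insert x U"
    using initial_eq_seg[OF A] by metis
  then show ?thesis
    using nb_adjacent_complement[OF A x(1) _ adj] xy y_eq S_eq by (simp add: U_def)
qed

text \<open>Harper's theorem. Outer induction on the dimension, inner induction on the sum of ranks:
  a compression does not enlarge the closed neighbourhood, and the sum drops until every compression
  fixes the family.\<close>

theorem card_nb_seg_le:
  assumes "finite A" "S \<subseteq> Pow A"
  shows "card (nb A (seg A (card S))) \<le> card (nb A S)"
  using assms
proof (induction "card A" arbitrary: A S rule: less_induct)
  case (less A)
  note A = less.prems(1)
  show ?case
    using less.prems(2)
  proof (induction "sum (rank A) S" arbitrary: S rule: less_induct)
    case inner: (less S)
    note S = inner.prems
    show ?case
    proof (cases "\<forall>i\<in>A. compress A i S = S")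
      case True
      then show ?thesis
        using card_nb_seg_compressed[OF A S] by blast
    next
      case False
      then obtain i where i: "i \<in> A" and ne: "compress A i S \<noteq> S"
        by blast
      let ?B = "A - {i}" and ?L = "lower_section i S" and ?U = "upper_section i S"
      have B: "finite ?B" "card ?B < card A"
        using A i by (auto intro: card_Diff1_less simp del: card_Diff_insert)
      have sub: "?L \<subseteq> Pow ?B" "?U \<subseteq> Pow ?B"
        using sections_subset[OF S] by auto
      \<comment> \<open>Initial segments are nested, so the left-hand union is only as large as its
        bigger member; induction in the smaller cube bounds one member, and the other has the size
        of \<open>W\<close>.\<close>
      have *: "card (nb ?B (seg ?B (card V)) \<union> seg ?B (card W)) \<le> card (nb ?B V \<union> W)"
        if V: "V \<subseteq> Pow ?B" and W: "W \<subseteq> Pow ?B" for V W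
      proof -
        have fin: "finite (nb ?B V)" "finite W"
          using B V W by (auto intro: finite_nb finite_subset)
        have "card (nb ?B (seg ?B (card V)) \<union> seg ?B (card W))
            = max (card (nb ?B (seg ?B (card V)))) (card (seg ?B (card W)))"
          using B by (intro card_initial_Un[of ?B] initial_nb seg_initial) auto
        also have "\<dots> \<le> max (card (nb ?B V)) (card W)"
          using less.hyps[OF B(2,1) V] card_seg[OF B(1) card_le_Pow[OF B(1) W]] by simp
        also have "\<dots> \<le> card (nb ?B V \<union> W)"
          using fin by (auto intro!: card_mono)
        finally show ?thesis .
      qed
      have "card (nb A (compress A i S)) \<le> card (nb A S)"
        using *[OF sub] *[OF sub(2,1)] card_nb_sections[OF A S i]
          card_nb_sections[OF A compress_subset[OF i] i, of S]
        by (simp add: sections_compress)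
      moreover have "card (nb A (seg A (card (compress A i S)))) \<le> card (nb A (compress A i S))"
        using inner.hyps[OF sum_rank_compress_less[OF A S i ne] compress_subset[OF i]] .
      ultimately show ?thesis
        using card_compress[OF A S i] by simp
    qed
  qed
qed

section \<open>Rank differences along edges\<close>

text \<open>Against a set without it, a minimal element decides every tie at once, so only sizes
  matter.\<close>

lemma prec_insert_min:
  assumes "finite u" "finite v" "\<forall>j\<in>u. a < j" "\<forall>j\<in>v. a < j"
  shows "prec (insert a u) v \<longleftrightarrow> card u < card v"
    "prec u (insert a v) \<longleftrightarrow> card u \<le> card v"
proof -
  have a: "a \<notin> u" "a \<notin> v"
    using assms by auto
  have "a \<in> insert a u - v" "\<forall>j<a. j \<in> insert a u \<longleftrightarrow> j \<in> v"
    using assms a by auto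
  then have "\<exists>m\<in>insert a u - v. \<forall>j<m. j \<in> insert a u \<longleftrightarrow> j \<in> v"
    by blast
  then show "prec (insert a u) v \<longleftrightarrow> card u < card v"
    using assms(1) a by (auto simp: prec_def)
  have "\<not> (\<exists>m\<in>u - insert a v. \<forall>j<m. j \<in> u \<longleftrightarrow> j \<in> insert a v)"
    using assms a by blast
  then show "prec u (insert a v) \<longleftrightarrow> card u \<le> card v"
    using assms(2) a by (auto simp: prec_def)
qed

definition small_subsets :: "nat set \<Rightarrow> nat \<Rightarrow> nat" where
  "small_subsets B r = card {z \<in> Pow B. card z < r}"

lemma small_subsets_0 [simp]: "small_subsets B 0 = 0"
  by (simp add: small_subsets_def)

lemma small_subsets_Suc:
  assumes "finite B"
  shows "small_subsets B (Suc r) = small_subsets B r + (card B choose r)"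
proof -
  have "{z \<in> Pow B. card z < Suc r} = {z \<in> Pow B. card z < r} \<union> {z. z \<subseteq> B \<and> card z = r}"
    by auto
  then have "small_subsets B (Suc r) = small_subsets B r + card {z. z \<subseteq> B \<and> card z = r}"
    unfolding small_subsets_def using assms by (subst card_Un_disjoint[symmetric]) auto
  then show ?thesis
    using n_subsets[OF assms] by simp
qed

text \<open>The predecessors are split by membership of \<open>a\<close>; comparisons between sets
  that differ at \<open>a\<close> depend on sizes only and give the terms
  \<open>small_subsets\<close>.\<close>

lemma rank_insert_min:
  assumes B: "finite B" "\<forall>j\<in>B. a < j" and x: "x \<subseteq> B"
  shows "rank (insert a B) (insert a x) = small_subsets B (Suc (card x)) + rank B x"
    and "rank (insert a B) x = rank B x + small_subsets B (card x)"
proof -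
  have fin: "finite z" if "z \<subseteq> B" for z
    using that B finite_subset by auto
  have a: "a \<notin> z" "\<forall>j\<in>z. a < j" if "z \<subseteq> B" for z
    using that B by auto
  have F: "finite {z \<in> Pow (insert a B). prec z y}" for y
    using B by simp
  have "lower_section a {z \<in> Pow (insert a B). prec z (insert a x)} = {z \<in> Pow B. card z < Suc (card x)}"
    "upper_section a {z \<in> Pow (insert a B). prec z (insert a x)} = {z \<in> Pow B. prec z x}"
    "lower_section a {z \<in> Pow (insert a B). prec z x} = {z \<in> Pow B. prec z x}"
    "upper_section a {z \<in> Pow (insert a B). prec z x} = {z \<in> Pow B. card z < card x}"
    using prec_insert_min fin a x prec_insert_iff
    by (auto simp: lower_section_def upper_section_def subset_insert less_Suc_eq_le)
  then show "rank (insert a B) (insert a x) = small_subsets B (Suc (card x)) + rank B x"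
    "rank (insert a B) x = rank B x + small_subsets B (card x)"
    unfolding rank_def small_subsets_def using card_sections[OF F, of _ a] by simp_all
qed

text \<open>Along the new least direction \<open>a\<close> the rank jump is a binomial coefficient,
  and along an old direction it grows by one. The additive form avoids truncated
  subtraction.\<close>

lemma rank_step_min:
  assumes B: "finite B" "\<forall>j\<in>B. a < j" and x: "x \<subseteq> B"
  shows "rank (insert a B) (insert a x) = rank (insert a B) x + (card B choose card x)"
    and "i \<in> B \<Longrightarrow> i \<notin> x \<Longrightarrow> rank (insert a B) (insert i x) + rank B x
      = rank (insert a B) x + rank B (insert i x) + (card B choose card x)"
    and "i \<in> B \<Longrightarrow> i \<notin> x \<Longrightarrow> rank (insert a B) (insert i (insert a x)) + rank B x
      = rank (insert a B) (insert a x) + rank B (insert i x) + (card B choose Suc (card x))"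
proof -
  have fin: "finite x"
    using x B finite_subset by auto
  show "rank (insert a B) (insert a x) = rank (insert a B) x + (card B choose card x)"
    using rank_insert_min[OF assms] by (simp add: small_subsets_Suc[OF B(1)])
  assume i: "i \<in> B" "i \<notin> x"
  then have ix: "insert i x \<subseteq> B" "card (insert i x) = Suc (card x)"
    using x fin by auto
  show "rank (insert a B) (insert i x) + rank B x
      = rank (insert a B) x + rank B (insert i x) + (card B choose card x)"
    using rank_insert_min(2)[OF assms] rank_insert_min(2)[OF B ix(1)] ix(2)
    by (simp add: small_subsets_Suc[OF B(1)])
  show "rank (insert a B) (insert i (insert a x)) + rank B x
      = rank (insert a B) (insert a x) + rank B (insert i x) + (card B choose Suc (card x))"
    using rank_insert_min(1)[OF assms] rank_insert_min(1)[OF B ix(1)] ix(2)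
    by (simp add: small_subsets_Suc[OF B(1)] insert_commute)
qed

section \<open>The largest change of rank along an edge\<close>

definition central_sum :: "nat \<Rightarrow> nat" where
  "central_sum d = (\<Sum>m<d. m choose (m div 2))"

lemma central_sum_Suc [simp]: "central_sum (Suc d) = central_sum d + (d choose (d div 2))"
  by (simp add: central_sum_def)

lemma central_sum_0 [simp]: "central_sum 0 = 0"
  by (simp add: central_sum_def)

lemma rank_insert_le:
  assumes "finite A" "x \<subseteq> A" "i \<in> A"
  shows "rank A (insert i x) \<le> rank A x + central_sum (card A)"
  using assms
proof (induction A arbitrary: x rule: finite_linorder_min_induct)
  case empty
  then show ?case by simp
next
  case (insert a B)
  have B: "finite B" "\<forall>j\<in>B. a < j" and aB: "a \<notin> B"
    using insert by auto
  have cA: "central_sum (card (insert a B)) = central_sum (card B) + (card B choose (card B div 2))"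
    using B aB by simp
  have mx: "card B choose r \<le> card B choose (card B div 2)" for r
    by (rule binomial_maximum)
  show ?case
  proof (cases "i \<in> x")
    case True
    then show ?thesis
      by (simp add: insert_absorb)
  next
    case i: False
    consider "i = a" "x \<subseteq> B" | "i \<in> B" "x \<subseteq> B" | y where "i \<in> B" "x = insert a y" "y \<subseteq> B"
    proof (cases "a \<in> x")
      case True
      then have "x = insert a (x - {a})" "x - {a} \<subseteq> B"
        using insert.prems by auto
      then show thesis
        using that(3)[of "x - {a}"] True i insert.prems by auto
    qed (use that(1,2) insert.prems i in auto)
    then show ?thesis
    proof cases
      case 1
      then show ?thesis
        using rank_step_min(1)[OF B 1(2)] mx[of "card x"] cA by simp
    next
      case 2
      then show ?thesis
        using rank_step_min(2)[OF B 2(2,1) i] mx[of "card x"] cA insert.IH[OF 2(2,1)] by linarith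
    next
      case 3
      then show ?thesis
        using rank_step_min(3)[OF B 3(3,1)] mx[of "Suc (card y)"] cA insert.IH[OF 3(3,1)] i by simp
    qed
  qed
qed

text \<open>The condition on \<open>card x\<close> keeps the recursion in the middle layer, where
  each added binomial coefficient is central; \<open>a\<close> joins the set whenever its size has
  to grow.\<close>

lemma rank_insert_eq_ex:
  assumes "finite A" "A \<noteq> {}"
  shows "\<exists>x i. x \<subseteq> A \<and> i \<in> A \<and> i \<notin> x \<and> card x = (card A - 1) div 2 \<and>
    rank A (insert i x) = rank A x + central_sum (card A)"
  using assms
proof (induction A rule: finite_linorder_min_induct)
  case empty
  then show ?case by simp
next
  case (insert a B)
  have B: "finite B" "\<forall>j\<in>B. a < j" and aB: "a \<notin> B"
    using insert by auto
  have cA: "central_sum (card (insert a B)) = central_sum (card B) + (card B choose (card B div 2))"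
    using B aB by simp
  show ?case
  proof (cases "B = {}")
    case True
    have "rank {a} (insert a {}) = rank {a} {} + central_sum (card {a})"
      using rank_step_min(1)[OF B, of "{}"] True by simp
    then show ?thesis
      using True by (intro exI[of _ "{}"] exI[of _ a]) auto
  next
    case False
    then obtain x i where x: "x \<subseteq> B" "i \<in> B" "i \<notin> x" "card x = (card B - 1) div 2"
      "rank B (insert i x) = rank B x + central_sum (card B)"
      using insert.IH by blast
    have ax: "a \<notin> x" "finite x" "a \<noteq> i"
      using x aB B finite_subset by auto
    have "card B > 0"
      using False B by (simp add: card_gt_0_iff)
    then consider "card x = card B div 2" | "Suc (card x) = card B div 2"
      using x(4) by linarith
    then show ?thesis
    proof cases
      case 1
      then have "rank (insert a B) (insert i x)
          = rank (insert a B) x + central_sum (card (insert a B))"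
        using rank_step_min(2)[OF B x(1,2,3)] x(5) cA by simp
      then show ?thesis
        using 1 x aB B by (intro exI[of _ x] exI[of _ i]) auto
    next
      case 2
      then have "rank (insert a B) (insert i (insert a x))
          = rank (insert a B) (insert a x) + central_sum (card (insert a B))"
        using rank_step_min(3)[OF B x(1,2,3)] x(5) cA by simp
      then show ?thesis
        using 2 x aB B ax by (intro exI[of _ "insert a x"] exI[of _ i]) auto
    qed
  qed
qed

text \<open>By Harper's theorem the initial segment ending at \<open>x\<close> is the worst case;
  its neighbourhood is again initial and contains \<open>insert i x\<close>, hence all predecessors
  of that set.\<close>

lemma card_nb_ge_rank:
  assumes A: "finite A" and x: "x \<subseteq> A" and i: "i \<in> A" "i \<notin> x"
    and S: "S \<subseteq> Pow A" "card S = Suc (rank A x)"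
  shows "Suc (rank A (insert i x)) \<le> card (nb A S)"
proof -
  let ?T = "nb A (seg A (card S))" and ?w = "insert i x"
  have T: "initial A ?T"
    using A by (intro initial_nb seg_initial)
  have "x \<in> seg A (card S)"
    using x S by (simp add: seg_def)
  then have w: "?w \<in> ?T"
    using nb_addI i by auto
  have "insert ?w {z \<in> Pow A. prec z ?w} \<subseteq> ?T"
    using w initialD[OF T w] by auto
  then have "card (insert ?w {z \<in> Pow A. prec z ?w}) \<le> card ?T"
    using initial_finite[OF A T] card_mono by blast
  moreover have "card (insert ?w {z \<in> Pow A. prec z ?w}) = Suc (rank A ?w)"
    using A by (simp add: rank_def)
  ultimately show ?thesis
    using card_nb_seg_le[OF A S(1)] by simp
qed

text \<open>For nonempty \<open>A\<close> the size is that of an initial segment ending at a set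
  whose rank jump attains \<open>central_sum\<close>.\<close>

lemma critical_size_ex:
  assumes A: "finite A"
  shows "\<exists>s\<le>2 ^ card A. \<forall>S\<subseteq>Pow A. card S = s \<longrightarrow> s + central_sum (card A) \<le> card (nb A S)"
proof (cases "A = {}")
  case True
  then show ?thesis
    by (intro exI[of _ 0]) auto
next
  case False
  then obtain x i where x: "x \<subseteq> A" "i \<in> A" "i \<notin> x"
    "rank A (insert i x) = rank A x + central_sum (card A)"
    using rank_insert_eq_ex[OF A] by blast
  show ?thesis
  proof (intro exI[of _ "Suc (rank A x)"] conjI allI impI)
    show "Suc (rank A x) \<le> 2 ^ card A"
      using rank_bound[OF A, of x] x by simp
    fix S assume "S \<subseteq> Pow A" "card S = Suc (rank A x)"
    then show "Suc (rank A x) + central_sum (card A) \<le> card (nb A S)"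
      using card_nb_ge_rank[OF A x(1,2,3)] x(4) by fastforce
  qed
qed

section \<open>Numberings with large gaps\<close>

lemma central_sum_le: "central_sum d \<le> 2 ^ d"
proof (induction d)
  case (Suc d)
  have "d choose (d div 2) \<le> 2 ^ d"
    by (rule binomial_le_pow2)
  then show ?case
    using Suc by simp
qed simp

section \<open>The extremal numbering\<close>

lemma card_toggle_parity:
  assumes "finite x"
  shows "odd (card (toggle i x)) \<longleftrightarrow> even (card x)"
proof (cases "i \<in> x")
  case True
  then have "Suc (card (x - {i})) = card x"
    using assms by (metis card_Suc_Diff1)
  then show ?thesis
    using True by (metis even_Suc toggle_def)
qed (use assms in \<open>simp add: toggle_def\<close>)

lemma toggle_in_Pow: "x \<in> Pow A \<Longrightarrow> i \<in> A \<Longrightarrow> toggle i x \<in> Pow A"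
  by (auto simp: toggle_def)

lemma rank_toggle_le:
  assumes "finite A" "x \<in> Pow A" "i \<in> A"
  shows "rank A (toggle i x) \<le> rank A x + central_sum (card A)"
proof (cases "i \<in> x")
  case True
  then have "card (x - {i}) < card x"
    using assms by (meson PowD card_Diff1_less finite_subset)
  then have "prec (x - {i}) x"
    by (simp add: prec_def)
  then have "rank A (x - {i}) < rank A x"
    using assms by (intro rank_less) auto
  then show ?thesis
    using True by (simp add: toggle_def)
qed (use assms rank_insert_le in \<open>auto simp: toggle_def\<close>)

text \<open>Odd vertices are shifted by \<open>2 ^ card B\<close>. An edge changes parity and moves
  the projection along at most one edge, so at most \<open>central_sum (card B)\<close> of the shift
  is lost.\<close>

lemma separated_numbering_ex:
  assumes B: "finite B" and a: "a \<notin> B"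
  shows "\<exists>\<eta>. bij_betw \<eta> (Pow (insert a B)) {1..2 * 2 ^ card B} \<and>
    (\<forall>x\<in>Pow (insert a B). \<forall>i\<in>insert a B.
      \<eta> x + (2 ^ card B - central_sum (card B)) \<le> \<eta> (toggle i x) \<or>
      \<eta> (toggle i x) + (2 ^ card B - central_sum (card B)) \<le> \<eta> x)"
proof -
  let ?A = "insert a B" and ?N = "2 ^ card B :: nat" and ?c = "central_sum (card B)"
  define \<eta> where "\<eta> x = Suc (rank B (x - {a})) + (if odd (card x) then ?N else 0)" for x
  have fin: "finite x" if "x \<in> Pow ?A" for x
    using that B by (meson PowD finite.insertI finite_subset)
  have proj: "x - {a} \<in> Pow B" if "x \<in> Pow ?A" for x
    using that by auto
  have rank_lt: "rank B (x - {a}) < ?N" if "x \<in> Pow ?A" for x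
    using rank_bound[OF B proj[OF that]] .
  have "inj_on \<eta> (Pow ?A)"
  proof (rule inj_onI)
    fix x y assume xy: "x \<in> Pow ?A" "y \<in> Pow ?A" "\<eta> x = \<eta> y"
    have par: "odd (card x) \<longleftrightarrow> odd (card y)"
      using xy(3) rank_lt[OF xy(1)] rank_lt[OF xy(2)] by (auto simp: \<eta>_def split: if_splits)
    then have "rank B (x - {a}) = rank B (y - {a})"
      using xy(3) by (simp add: \<eta>_def)
    then have eq: "x - {a} = y - {a}"
      using rank_inj[OF B] proj xy by (auto dest: inj_onD)
    \<comment> \<open>Two distinct vertices over the same point have opposite parity, so projection
      and parity determine the vertex.\<close>
    have "y \<noteq> toggle a x"
      using par card_toggle_parity[OF fin[OF xy(1)], of a] by auto
    moreover have "x = y \<or> y = toggle a x"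
      using eq by (auto simp: toggle_def split: if_splits)
    ultimately show "x = y"
      by blast
  qed
  moreover have "\<eta> ` Pow ?A = {1..2 * ?N}"
  proof (rule card_subset_eq)
    show "\<eta> ` Pow ?A \<subseteq> {1..2 * ?N}"
    proof (rule image_subsetI)
      fix x assume "x \<in> Pow ?A"
      from rank_lt[OF this] show "\<eta> x \<in> {1..2 * ?N}"
        by (simp add: \<eta>_def)
    qed
    show "card (\<eta> ` Pow ?A) = card {1..2 * ?N}"
      using card_image[OF \<open>inj_on \<eta> (Pow ?A)\<close>] B a by (simp add: card_Pow)
  qed simp
  ultimately have "bij_betw \<eta> (Pow ?A) {1..2 * ?N}"
    by (simp add: bij_betw_def)
  moreover have "\<eta> x + (?N - ?c) \<le> \<eta> (toggle i x) \<or> \<eta> (toggle i x) + (?N - ?c) \<le> \<eta> x"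
    if x: "x \<in> Pow ?A" and i: "i \<in> ?A" for x i
  proof -
    have c: "?c \<le> ?N"
      by (rule central_sum_le)
    have step: "rank B (toggle j z - {a}) \<le> rank B (z - {a}) + ?c" if "z \<in> Pow ?A" "j \<in> ?A" for z j
    proof (cases "j = a")
      case True
      then have "toggle j z - {a} = z - {a}"
        by (auto simp: toggle_def)
      then show ?thesis
        by simp
    next
      case False
      then have "toggle j z - {a} = toggle j (z - {a})"
        by (auto simp: toggle_def)
      then show ?thesis
        using rank_toggle_le[OF B proj[OF that(1)], of j] that False by simp
    qed
    have 1: "rank B (toggle i x - {a}) \<le> rank B (x - {a}) + ?c"
      by (rule step[OF x i])
    have 2: "rank B (x - {a}) \<le> rank B (toggle i x - {a}) + ?c"
      using step[OF toggle_in_Pow[OF x i] i] by simp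
    show ?thesis
      using card_toggle_parity[OF fin[OF x], of i] 1 2 c
      by (cases "odd (card x)") (auto simp: \<eta>_def)
  qed
  ultimately show ?thesis
    by blast
qed

text \<open>A discrete Poincare lemma: increments that agree on both ways around every square
  integrate to a height function. The given \<open>h\<close> is extended to sets containing
  \<open>a\<close> by the increment in direction \<open>a\<close>; squares through \<open>a\<close>
  give consistency.\<close>

lemma potential_ex:
  fixes \<theta> :: "'a set \<Rightarrow> 'a \<Rightarrow> int"
  assumes "finite A"
    and "\<And>x i j. x \<subseteq> A \<Longrightarrow> i \<in> A - x \<Longrightarrow> j \<in> A - x \<Longrightarrow> i \<noteq> j \<Longrightarrow>
      \<theta> x j + \<theta> (insert j x) i = \<theta> x i + \<theta> (insert i x) j"
  shows "\<exists>h. \<forall>x\<subseteq>A. \<forall>i\<in>A - x. h (insert i x) = h x + \<theta> x i"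
  using assms
proof (induction A rule: finite_induct)
  case empty
  then show ?case by simp
next
  case (insert a A)
  have "\<exists>h. \<forall>x\<subseteq>A. \<forall>i\<in>A - x. h (insert i x) = h x + \<theta> x i"
    by (rule insert.IH) (rule insert.prems, auto)
  then obtain h where h: "\<And>x i. x \<subseteq> A \<Longrightarrow> i \<in> A - x \<Longrightarrow> h (insert i x) = h x + \<theta> x i"
    by blast
  define g where "g x = (if a \<in> x then h (x - {a}) + \<theta> (x - {a}) a else h x)" for x
  have "g (insert i x) = g x + \<theta> x i" if x: "x \<subseteq> insert a A" and i: "i \<in> insert a A - x" for x i
  proof -
    consider "i = a" | "i \<noteq> a" "a \<notin> x" | "i \<noteq> a" "a \<in> x"
      by blast
    then show ?thesis
    proof cases
      case 1
      then show ?thesis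
        using i by (simp add: g_def)
    next
      case 2
      then show ?thesis
        using h[of x i] x i by (auto simp: g_def)
    next
      case 3
      let ?y = "x - {a}"
      have y: "?y \<subseteq> A" "i \<in> A - ?y" "insert a ?y = x" "insert i x - {a} = insert i ?y"
        using x i 3 by auto
      have "\<theta> ?y i + \<theta> (insert i ?y) a = \<theta> ?y a + \<theta> x i"
        using insert.prems[of ?y a i] y 3 insert.hyps by auto
      then show ?thesis
        using h[OF y(1,2)] y 3 by (simp add: g_def)
    qed
  qed
  then show ?case
    by blast
qed

text \<open>The cube on \<open>insert a B\<close> is projected along \<open>a\<close> onto the cube
  on \<open>B\<close>; \<open>k\<close> is a lower bound for all edge gaps.\<close>

locale separated_numbering =
  fixes B :: "nat set" and a :: nat and \<eta> :: "nat set \<Rightarrow> nat" and k :: nat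
  assumes finite_B: "finite B" and a_notin: "a \<notin> B"
    and bij: "bij_betw \<eta> (Pow (insert a B)) {1..2 * 2 ^ card B}"
    and sep: "x \<in> Pow (insert a B) \<Longrightarrow> i \<in> insert a B \<Longrightarrow>
      \<eta> x + k \<le> \<eta> (toggle i x) \<or> \<eta> (toggle i x) + k \<le> \<eta> x"
    and k_pos: "0 < k"
begin

section \<open>Labels and windows of \<open>k\<close> consecutive labels\<close>

abbreviation "A \<equiv> insert a B"
abbreviation "N \<equiv> 2 ^ card B :: nat"

lemma label_bounds: "x \<in> Pow A \<Longrightarrow> 1 \<le> \<eta> x \<and> \<eta> x \<le> 2 * N"
  using bij_betwE[OF bij] by auto

lemma label_inj: "x \<in> Pow A \<Longrightarrow> y \<in> Pow A \<Longrightarrow> \<eta> x = \<eta> y \<Longrightarrow> x = y"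
  using bij by (auto simp: bij_betw_def dest: inj_onD)

lemma card_labels_in:
  assumes "L \<subseteq> {1..2 * N}"
  shows "card {x \<in> Pow A. \<eta> x \<in> L} = card L"
proof -
  have "\<eta> ` {x \<in> Pow A. \<eta> x \<in> L} = \<eta> ` Pow A \<inter> L"
    by auto
  then have "\<eta> ` {x \<in> Pow A. \<eta> x \<in> L} = L"
    using bij assms by (simp add: bij_betw_def Int_absorb1)
  moreover have "inj_on \<eta> {x \<in> Pow A. \<eta> x \<in> L}"
    by (rule inj_on_subset[OF bij_betw_imp_inj_on[OF bij]]) auto
  ultimately show ?thesis
    by (metis card_image)
qed

lemma k_le: "k < 2 * N"
proof -
  have "{} \<in> Pow A" "{a} \<in> Pow A" "toggle a {} = {a}"
    by (auto simp: toggle_def)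
  then show ?thesis
    using sep[of "{}" a] label_bounds[of "{}"] label_bounds[of "{a}"] by auto
qed

definition window :: "nat \<Rightarrow> nat set set" where
  "window \<tau> = {u \<in> Pow A. \<eta> u \<in> {\<tau>..<\<tau> + k}}"

lemma card_window:
  assumes "1 \<le> \<tau>" "\<tau> + k \<le> 2 * N + 1"
  shows "card (window \<tau>) = k"
proof -
  have "{\<tau>..<\<tau> + k} \<subseteq> {1..2 * N}"
    using assms by auto
  from card_labels_in[OF this] show ?thesis
    by (simp add: window_def)
qed

lemma window_no_edge:
  assumes "u \<in> window \<tau>" "i \<in> A"
  shows "toggle i u \<notin> window \<tau>"
  using assms sep[of u i] by (auto simp: window_def)

text \<open>Two window vertices over the same point would be joined by an edge with gap below
  \<open>k\<close>.\<close>

lemma inj_on_window: "inj_on (\<lambda>u. u - {a}) (window \<tau>)"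
proof (rule inj_onI)
  fix u v assume uv: "u \<in> window \<tau>" "v \<in> window \<tau>" "u - {a} = v - {a}"
  then have "u = v \<or> v = toggle a u"
    by (auto simp: toggle_def split: if_splits)
  then show "u = v"
    using window_no_edge[OF uv(1), of a] uv(2) by auto
qed

text \<open>\<open>P j \<tau>\<close> consists of the fibres below height \<open>j - 1\<close> and the projections of the vertices at
  height \<open>j\<close> with label at least \<open>\<tau>\<close>; dually for \<open>Q j \<tau>\<close>. The projection of the window of labels
  starting at \<open>\<tau>\<close> is contained in their union.\<close>

lemma balanced_bound:
  fixes h :: "nat set \<Rightarrow> int"
  assumes h: "\<And>x i. x \<in> Pow A \<Longrightarrow> i \<in> A \<Longrightarrow> i \<notin> x \<Longrightarrow>
      h (insert i x) = h x + (if \<eta> x < \<eta> (insert i x) then 1 else - 1)"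
  shows "k + central_sum (card B) \<le> N"
proof -
  have edge: "(h (toggle i x) = h x + 1 \<and> \<eta> x + k \<le> \<eta> (toggle i x)) \<or>
      (h (toggle i x) = h x - 1 \<and> \<eta> (toggle i x) + k \<le> \<eta> x)" if "x \<in> Pow A" "i \<in> A" for x i
  proof (cases "i \<in> x")
    case True
    then have "h x = h (x - {i}) + (if \<eta> (x - {i}) < \<eta> x then 1 else - 1)"
      using h[of "x - {i}" i] that by (simp add: insert_absorb subset_iff)
    then show ?thesis
      using sep[OF that] True k_pos by (auto simp: toggle_def split: if_splits)
  next
    case False
    then show ?thesis
      using sep[OF that] h[OF that False] k_pos by (auto simp: toggle_def split: if_splits)
  qed
  have fibre: "(h (insert a x) = h x + 1 \<and> \<eta> x + k \<le> \<eta> (insert a x)) \<or>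
      (h (insert a x) = h x - 1 \<and> \<eta> (insert a x) + k \<le> \<eta> x)" if "x \<in> Pow B" for x
  proof -
    have "x \<in> Pow A" "toggle a x = insert a x"
      using that a_notin by (auto simp: toggle_def)
    then show ?thesis
      using edge[of x a] by simp
  qed
  \<comment> \<open>The two heights in the fibre over \<open>x\<close> are \<open>ty x\<close> and
    \<open>ty x + 1\<close>.\<close>
  define ty where "ty x = min (h x) (h (insert a x))" for x
  define P where "P j \<tau> = {x \<in> Pow B. ty x < j - 1 \<or> (h x = j \<and> \<tau> \<le> \<eta> x) \<or>
      (h (insert a x) = j \<and> \<tau> \<le> \<eta> (insert a x))}" for j \<tau>
  define Q where "Q j \<tau> = {x \<in> Pow B. ty x > j + 1 \<or> (h x = j + 1 \<and> \<eta> x < \<tau> + k) \<or>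
      (h (insert a x) = j + 1 \<and> \<eta> (insert a x) < \<tau> + k)}" for j \<tau>
  have P_sub: "P j \<tau> \<subseteq> Pow B" and Q_sub: "Q j \<tau> \<subseteq> Pow B" for j \<tau>
    by (auto simp: P_def Q_def)
  have finP: "finite (P j \<tau>)" and finQ: "finite (Q j \<tau>)" for j \<tau>
    using finite_B by (auto simp: P_def Q_def)
  \<comment> \<open>An edge from height \<open>j\<close> to \<open>j + 1\<close> raises the label by
    at least \<open>k\<close>, which the thresholds \<open>\<tau>\<close> and
    \<open>\<tau> + k\<close> exclude; all other combinations contradict the heights.\<close>
  have disj: "nb B (P j \<tau>) \<inter> Q j \<tau> = {}" for j \<tau>
  proof -
    have "x \<notin> Q j \<tau>" if "x \<in> P j \<tau>" for x
      using that fibre[of x] by (auto simp: P_def Q_def ty_def min_def)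
    moreover have "toggle i x \<notin> Q j \<tau>" if x: "x \<in> P j \<tau>" and i: "i \<in> B" for x i
    proof
      assume q: "toggle i x \<in> Q j \<tau>"
      define y where "y = toggle i x"
      have xB: "x \<in> Pow B"
        using x by (simp add: P_def)
      then have yB: "y \<in> Pow B"
        using i toggle_in_Pow by (simp add: y_def)
      have ins: "toggle i (insert a x) = insert a y"
        using i a_notin xB by (auto simp: toggle_def y_def)
      have e1: "(h y = h x + 1 \<and> \<eta> x + k \<le> \<eta> y) \<or> (h y = h x - 1 \<and> \<eta> y + k \<le> \<eta> x)"
        using edge[of x i] xB i by (auto simp: y_def)
      have e2: "(h (insert a y) = h (insert a x) + 1 \<and> \<eta> (insert a x) + k \<le> \<eta> (insert a y)) \<or>
          (h (insert a y) = h (insert a x) - 1 \<and> \<eta> (insert a y) + k \<le> \<eta> (insert a x))"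
        using edge[of "insert a x" i] xB i ins by auto
      have p: "h x < j - 1 \<or> h (insert a x) < j - 1 \<or> (h x = j \<and> \<tau> \<le> \<eta> x) \<or>
          (h (insert a x) = j \<and> \<tau> \<le> \<eta> (insert a x))"
        using x by (auto simp: P_def ty_def min_less_iff_disj)
      have q': "(j + 1 < h y \<and> j + 1 < h (insert a y)) \<or> (h y = j + 1 \<and> \<eta> y < \<tau> + k) \<or>
          (h (insert a y) = j + 1 \<and> \<eta> (insert a y) < \<tau> + k)"
        using q by (simp add: Q_def ty_def y_def)
      show False
        using e1 e2 fibre[OF xB] fibre[OF yB] p q' by (elim disjE conjE) linarith+
    qed
    ultimately show ?thesis
      by (auto simp: nb_def)
  qed
  \<comment> \<open>A window vertex at height at most \<open>j\<close> projects into
    \<open>P\<close>, a higher one into \<open>Q\<close>. At heights \<open>j - 1\<close> and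
    \<open>j + 2\<close> the other end of the fibre, with a label at least \<open>k\<close> away,
    may serve as witness.\<close>
  have cover: "k \<le> card (P j \<tau>) + card (Q j \<tau>)" if "1 \<le> \<tau>" "\<tau> + k \<le> 2 * N + 1" for j \<tau>
  proof -
    have "u - {a} \<in> P j \<tau> \<union> Q j \<tau>" if u: "u \<in> window \<tau>" for u
    proof -
      define x where "x = u - {a}"
      have xB: "x \<in> Pow B"
        using u by (auto simp: window_def x_def)
      have "u = x \<or> u = insert a x"
        by (auto simp: x_def)
      then show ?thesis
        using u fibre[OF xB] xB unfolding x_def[symmetric]
        by (auto simp: P_def Q_def ty_def window_def min_def)
    qed
    then have "(\<lambda>u. u - {a}) ` window \<tau> \<subseteq> P j \<tau> \<union> Q j \<tau>"
      by auto
    then have "card ((\<lambda>u. u - {a}) ` window \<tau>) \<le> card (P j \<tau> \<union> Q j \<tau>)"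
      using finP finQ by (intro card_mono) auto
    also have "\<dots> \<le> card (P j \<tau>) + card (Q j \<tau>)"
      by (rule card_Un_le)
    finally show ?thesis
      using card_image[OF inj_on_window] card_window[OF that] by simp
  qed
  obtain s where s: "s \<le> N"
    "\<And>S. S \<subseteq> Pow B \<Longrightarrow> card S = s \<Longrightarrow> s + central_sum (card B) \<le> card (nb B S)"
    using critical_size_ex[OF finite_B] by blast
  \<comment> \<open>At the critical size the neighbourhood of \<open>P\<close> has at least
    \<open>s + central_sum (card B)\<close> points and the disjoint set \<open>Q\<close> at least
    \<open>k - s\<close>.\<close>
  have hit: ?thesis if \<tau>: "1 \<le> \<tau>" "\<tau> + k \<le> 2 * N + 1" and c: "card (P j \<tau>) = s" for j \<tau>
  proof -
    have "card (nb B (P j \<tau>)) + card (Q j \<tau>) = card (nb B (P j \<tau>) \<union> Q j \<tau>)"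
      using disj finQ finite_nb[OF finite_B P_sub] by (intro card_Un_disjoint[symmetric]) auto
    also have "\<dots> \<le> N"
      using nb_subset[OF P_sub] Q_sub by (intro card_le_Pow[OF finite_B]) auto
    finally show ?thesis
      using cover[OF \<tau>, of j] s(2)[OF P_sub c] c by linarith
  qed
  show ?thesis
  proof (rule ccontr)
    assume contra: "\<not> ?thesis"
    let ?E = "2 * N + 1 - k"
    have E: "1 \<le> ?E" "?E + k = 2 * N + 1"
      using k_le by auto
    have ne: "card (P j \<tau>) \<noteq> s" if "1 \<le> \<tau>" "\<tau> \<le> ?E" for j \<tau>
      using hit[OF that(1), of j] that E contra by auto
    \<comment> \<open>Raising the threshold by one can only remove the point under the vertex
      labelled \<open>\<tau>\<close>.\<close>
    have drop: "card (P j \<tau>) \<le> Suc (card (P j (Suc \<tau>)))" for j \<tau>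
    proof -
      have "\<exists>v. P j \<tau> - P j (Suc \<tau>) \<subseteq> {v}"
      proof (cases "\<exists>u\<in>Pow A. \<eta> u = \<tau>")
        case True
        then obtain u where u: "u \<in> Pow A" "\<eta> u = \<tau>"
          by blast
        have "x = u - {a}" if x: "x \<in> P j \<tau> - P j (Suc \<tau>)" for x
        proof -
          have "x \<in> Pow B" and "\<eta> x = \<tau> \<or> \<eta> (insert a x) = \<tau>"
            using x by (auto simp: P_def)
          then have "x = u \<or> insert a x = u"
            using u label_inj[of x u] label_inj[of "insert a x" u] by auto
          then show ?thesis
            using \<open>x \<in> Pow B\<close> a_notin by auto
        qed
        then show ?thesis
          by blast
      next
        case False
        have "P j \<tau> - P j (Suc \<tau>) = {}"
        proof -
          have "x \<in> P j (Suc \<tau>)" if "x \<in> P j \<tau>" for x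
          proof -
            have "\<eta> x \<noteq> \<tau>" "\<eta> (insert a x) \<noteq> \<tau>"
              using False that by (auto simp: P_def)
            then show ?thesis
              using that by (auto simp: P_def Suc_le_eq)
          qed
          then show ?thesis
            by blast
        qed
        then show ?thesis
          by blast
      qed
      then obtain v where v: "P j \<tau> \<subseteq> insert v (P j (Suc \<tau>))"
        by blast
      then have "card (P j \<tau>) \<le> card (insert v (P j (Suc \<tau>)))"
        using finP by (intro card_mono) auto
      also have "\<dots> \<le> Suc (card (P j (Suc \<tau>)))"
        by (rule card_insert_le_m1[THEN order_trans]) (auto simp: finP card_insert_if)
      finally show ?thesis .
    qed
    have along: "s < card (P j \<tau>)" if start: "s < card (P j 1)" and "1 \<le> \<tau>" "\<tau> \<le> ?E" for j \<tau>
      using that(2,3)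
    proof (induction \<tau> rule: dec_induct)
      case base
      then show ?case
        using start by simp
    next
      case (step \<tau>)
      then have "s < card (P j \<tau>)" "card (P j (Suc \<tau>)) \<noteq> s"
        using ne[of "Suc \<tau>" j] by auto
      then show ?case
        using drop[of j \<tau>] by linarith
    qed
    \<comment> \<open>Going down one height does not shrink the set: a vertex at height
      \<open>j\<close> with label at least \<open>?E\<close> has its fibre partner at height
      \<open>j - 1\<close>, since a partner at \<open>j + 1\<close> would need a label above
      \<open>2 * N\<close>. So the size \<open>s\<close> cannot be skipped here either.\<close>
    have "P j ?E \<subseteq> P (j - 1) 1" for j
    proof
      fix x assume x: "x \<in> P j ?E"
      then have xB: "x \<in> Pow B"
        by (simp add: P_def)
      then have "1 \<le> \<eta> x" "\<eta> x \<le> 2 * N" "1 \<le> \<eta> (insert a x)" "\<eta> (insert a x) \<le> 2 * N"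
        using label_bounds[of x] label_bounds[of "insert a x"] by auto
      then show "x \<in> P (j - 1) 1"
        using x xB fibre[OF xB] E by (auto simp: P_def ty_def min_def)
    qed
    then have next_level: "s < card (P (j - 1) 1)" if "s < card (P j 1)" for j
      using along[OF that E(1)] finP by (meson card_mono le_refl order_less_le_trans)
    define H where "H = Max ((\<lambda>x. \<bar>h x\<bar>) ` Pow A)"
    have H: "\<bar>h x\<bar> \<le> H" if "x \<in> Pow A" for x
      unfolding H_def using that finite_B by (intro Max_ge) auto
    have "P (H + 2) 1 = Pow B"
    proof -
      have "ty x < (H + 2) - 1" if "x \<in> Pow B" for x
      proof -
        have "x \<in> Pow A"
          using that by auto
        from H[OF this] show ?thesis
          by (auto simp: ty_def min_def)
      qed
      then show ?thesis
        by (auto simp: P_def)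
    qed
    then have "card (P (H + 2) 1) = N"
      using finite_B by (simp add: card_Pow)
    then have top: "s < card (P (H + 2) 1)"
      using s(1) ne[of 1 "H + 2"] E by auto
    have "s < card (P (H + 2 - int m) 1)" for m
    proof (induction m)
      case 0
      then show ?case
        using top by simp
    next
      case (Suc m)
      then show ?case
        using next_level[of "H + 2 - int m"] by (simp add: algebra_simps)
    qed
    \<comment> \<open>This many steps lead from \<open>H + 2\<close> to \<open>- H - 2\<close>,
      which lies below all heights, so the set is empty.\<close>
    then have "s < card (P (H + 2 - int (nat (2 * H + 4))) 1)" .
    moreover have "P (H + 2 - int (nat (2 * H + 4))) 1 = {}"
    proof -
      have "0 \<le> H"
        using H[of "{}"] by simp
      then have "H + 2 - int (nat (2 * H + 4)) = - H - 2"
        by simp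
      moreover have "x \<notin> P (- H - 2) 1" for x
      proof
        assume x: "x \<in> P (- H - 2) 1"
        then have "x \<in> Pow A" "insert a x \<in> Pow A"
          by (auto simp: P_def)
        then show False
          using x H[of x] H[of "insert a x"] by (auto simp: P_def ty_def min_def split: if_splits)
      qed
      ultimately show ?thesis
        by auto
    qed
    ultimately show False
      by simp
  qed
qed

end

section \<open>Unbalanced faces\<close>

text \<open>Unequal totals force the labels to grow along three consecutive edges of the 4-cycle.
  The four labels are then at least \<open>k\<close> apart, and each interval of \<open>G\<close>
  holds the values possible for one of the four positions.\<close>

lemma unbalanced_four_cycle:
  fixes \<alpha> \<beta> \<gamma> \<delta> k M :: nat
  assumes "\<alpha> + k \<le> \<beta> \<or> \<beta> + k \<le> \<alpha>" "\<alpha> + k \<le> \<gamma> \<or> \<gamma> + k \<le> \<alpha>"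
    and "\<beta> + k \<le> \<delta> \<or> \<delta> + k \<le> \<beta>" "\<gamma> + k \<le> \<delta> \<or> \<delta> + k \<le> \<gamma>"
    and "0 < k" "0 < \<alpha>" "0 < \<beta>" "0 < \<gamma>" "0 < \<delta>" "\<alpha> \<le> M" "\<beta> \<le> M" "\<gamma> \<le> M" "\<delta> \<le> M"
    and "(if \<alpha> < \<gamma> then 1 else - 1) + (if \<gamma> < \<delta> then 1 else - 1)
      \<noteq> (if \<alpha> < \<beta> then 1 else - 1) + (if \<beta> < \<delta> then 1 else - 1 :: int)"
  defines "G \<equiv> {1..M - 3 * k} \<union> {k + 1..M - 2 * k} \<union> {2 * k + 1..M - k} \<union> {3 * k + 1..M}"
  shows "\<alpha> \<in> G" "\<beta> \<in> G" "\<gamma> \<in> G" "\<delta> \<in> G" "3 * k < M"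
proof -
  have "\<alpha> \<in> G \<and> \<beta> \<in> G \<and> \<gamma> \<in> G \<and> \<delta> \<in> G \<and> 3 * k < M"
    using assms(1-4)
  proof (elim disjE)
  qed (use assms(5-14) in \<open>simp add: G_def; linarith\<close>)+
  then show "\<alpha> \<in> G" "\<beta> \<in> G" "\<gamma> \<in> G" "\<delta> \<in> G" "3 * k < M"
    by blast+
qed

context separated_numbering
begin

definition \<theta> :: "nat set \<Rightarrow> nat \<Rightarrow> int" where
  "\<theta> x i = (if \<eta> x < \<eta> (insert i x) then 1 else - 1)"

text \<open>Failure of the square condition of \<open>potential_ex\<close> on the face at
  \<open>x\<close> in directions \<open>i\<close> and \<open>j\<close>.\<close>

definition unbalanced :: "nat set \<Rightarrow> nat \<Rightarrow> nat \<Rightarrow> bool" where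
  "unbalanced x i j \<longleftrightarrow> \<theta> x j + \<theta> (insert j x) i \<noteq> \<theta> x i + \<theta> (insert i x) j"

definition face :: "nat set \<Rightarrow> nat \<Rightarrow> nat \<Rightarrow> nat set set" where
  "face x i j = {x, insert i x, insert j x, insert i (insert j x)}"

definition G :: "nat set" where
  "G = {1..2 * N - 3 * k} \<union> {k + 1..2 * N - 2 * k} \<union> {2 * k + 1..2 * N - k} \<union> {3 * k + 1..2 * N}"

definition extremal :: "nat set set" where
  "extremal = {x \<in> Pow A. \<eta> x \<in> G}"

lemma sep_insert:
  assumes "x \<subseteq> A" "i \<in> A" "i \<notin> x"
  shows "\<eta> x + k \<le> \<eta> (insert i x) \<or> \<eta> (insert i x) + k \<le> \<eta> x"
  using sep[of x i] assms by (simp add: toggle_def)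

lemma unbalanced_extremal:
  assumes x: "x \<subseteq> A" and i: "i \<in> A" "i \<notin> x" and j: "j \<in> A" "j \<notin> x" and ij: "i \<noteq> j"
    and unb: "unbalanced x i j"
  shows "face x i j \<subseteq> extremal" "3 * k < 2 * N"
proof -
  have sub: "x \<in> Pow A" "insert i x \<in> Pow A" "insert j x \<in> Pow A" "insert i (insert j x) \<in> Pow A"
    using x i j by auto
  have e: "\<eta> x + k \<le> \<eta> (insert i x) \<or> \<eta> (insert i x) + k \<le> \<eta> x"
    "\<eta> x + k \<le> \<eta> (insert j x) \<or> \<eta> (insert j x) + k \<le> \<eta> x"
    "\<eta> (insert i x) + k \<le> \<eta> (insert i (insert j x)) \<or> \<eta> (insert i (insert j x)) + k \<le> \<eta> (insert i x)"
    "\<eta> (insert j x) + k \<le> \<eta> (insert i (insert j x)) \<or> \<eta> (insert i (insert j x)) + k \<le> \<eta> (insert j x)"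
    using sep_insert[of x i] sep_insert[of x j] sep_insert[of "insert i x" j] sep_insert[of "insert j x" i]
      x i j ij by (auto simp: insert_commute)
  have pos: "0 < \<eta> u" "\<eta> u \<le> 2 * N" if "u \<in> Pow A" for u
    using label_bounds[OF that] by auto
  have u: "(if \<eta> x < \<eta> (insert j x) then 1 else - 1) +
       (if \<eta> (insert j x) < \<eta> (insert i (insert j x)) then 1 else - 1)
      \<noteq> (if \<eta> x < \<eta> (insert i x) then 1 else - 1) +
       (if \<eta> (insert i x) < \<eta> (insert i (insert j x)) then 1 else - 1 :: int)"
    using unb unfolding unbalanced_def \<theta>_def by (simp add: insert_commute)
  note four = unbalanced_four_cycle[OF e k_pos pos(1)[OF sub(1)] pos(1)[OF sub(2)] pos(1)[OF sub(3)]
      pos(1)[OF sub(4)] pos(2)[OF sub(1)] pos(2)[OF sub(2)] pos(2)[OF sub(3)] pos(2)[OF sub(4)] u]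
  show "face x i j \<subseteq> extremal"
    using four(1-4) sub by (simp add: face_def extremal_def G_def)
  show "3 * k < 2 * N"
    by (rule four(5))
qed

text \<open>With suitable signs the defects of the six faces of a 3-cube sum to zero, since each
  edge lies on two faces; so an unbalanced face is never the only one.\<close>

lemma unbalanced_cube:
  assumes "unbalanced y i j \<or> unbalanced (insert l y) i j"
  shows "(unbalanced y i j \<and> unbalanced (insert l y) i j) \<or>
    unbalanced y i l \<or> unbalanced (insert j y) i l \<or> unbalanced y j l \<or> unbalanced (insert i y) j l"
  using assms unfolding unbalanced_def by (simp add: insert_commute) linarith

text \<open>A second unbalanced face of the 3-cube in directions \<open>i\<close>, \<open>j\<close>,
  \<open>l\<close> has at least two vertices off the given face.\<close>

lemma extremal_neighbours:
  assumes x: "x \<subseteq> A" and i: "i \<in> A" "i \<notin> x" and j: "j \<in> A" "j \<notin> x" and ij: "i \<noteq> j"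
    and unb: "unbalanced x i j" and l: "l \<in> A" "l \<noteq> i" "l \<noteq> j"
  shows "\<exists>u\<in>face x i j. \<exists>v\<in>face x i j. u \<noteq> v \<and> toggle l u \<in> extremal \<and> toggle l v \<in> extremal"
proof -
  define y where "y = x - {l}"
  have y: "y \<subseteq> A" "i \<notin> y" "j \<notin> y" "l \<notin> y" and xy: "x = y \<or> x = insert l y"
    using x i j by (auto simp: y_def)
  have ext: "face y i j \<subseteq> extremal \<and> face (insert l y) i j \<subseteq> extremal \<or> face y i l \<subseteq> extremal \<or>
     face (insert j y) i l \<subseteq> extremal \<or> face y j l \<subseteq> extremal \<or> face (insert i y) j l \<subseteq> extremal"
    using unbalanced_cube[of y i j l] unb xy y i j l ij
      unbalanced_extremal(1)[of y i j] unbalanced_extremal(1)[of "insert l y" i j]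
      unbalanced_extremal(1)[of y i l] unbalanced_extremal(1)[of "insert j y" i l]
      unbalanced_extremal(1)[of y j l] unbalanced_extremal(1)[of "insert i y" j l]
    by auto
  have tg: "toggle l z = insert l z" if "l \<notin> z" for z
    using that by (simp add: toggle_def)
  have tg': "toggle l (insert l z) = z" if "l \<notin> z" for z
    using that by (simp add: toggle_def)
  define y1 y2 y3 where "y1 = insert i y" and "y2 = insert j y" and "y3 = insert i (insert j y)"
  have nl: "l \<notin> y" "l \<notin> y1" "l \<notin> y2" "l \<notin> y3"
    using y l by (auto simp: y1_def y2_def y3_def)
  have ne: "y \<noteq> y1" "y \<noteq> y2" "y1 \<noteq> y3" "y2 \<noteq> y3"
    "insert l y \<noteq> insert l y1" "insert l y \<noteq> insert l y2" "insert l y1 \<noteq> insert l y3" "insert l y2 \<noteq> insert l y3"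
  proof -
    have "i \<notin> y" "i \<in> y1" "j \<notin> y" "j \<in> y2" "i \<notin> y2" "i \<in> y3" "j \<notin> y1" "j \<in> y3"
      using y ij by (auto simp: y1_def y2_def y3_def)
    then show "y \<noteq> y1" "y \<noteq> y2" "y1 \<noteq> y3" "y2 \<noteq> y3"
      "insert l y \<noteq> insert l y1" "insert l y \<noteq> insert l y2" "insert l y1 \<noteq> insert l y3" "insert l y2 \<noteq> insert l y3"
      using l by (metis insert_iff)+
  qed
  have fy: "face y i j = {y, y1, y2, y3}" and fly: "face (insert l y) i j = {insert l y, insert l y1, insert l y2, insert l y3}"
    by (auto simp: face_def y1_def y2_def y3_def insert_commute)
  \<comment> \<open>In every case some edge of the face is extremal together with its translate in
    direction \<open>l\<close>.\<close>
  have pairs: "{y, y1, insert l y, insert l y1} \<subseteq> extremal \<or> {y2, y3, insert l y2, insert l y3} \<subseteq> extremal \<or>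
      {y, y2, insert l y, insert l y2} \<subseteq> extremal \<or> {y1, y3, insert l y1, insert l y3} \<subseteq> extremal"
    using ext unfolding fy fly by (auto simp: face_def y1_def y2_def y3_def insert_commute)
  show ?thesis
    using xy
  proof
    assume "x = y"
    then have "face x i j = {y, y1, y2, y3}"
      using fy by simp
    then show ?thesis
      using pairs ne nl by (auto simp: tg)
  next
    assume "x = insert l y"
    then have "face x i j = {insert l y, insert l y1, insert l y2, insert l y3}"
      using fly by simp
    then show ?thesis
      using pairs ne nl by (auto simp: tg')
  qed
qed

text \<open>The face contributes four extremal vertices and each of the other
  \<open>card B - 1\<close> directions at least two more, while \<open>G\<close> has at most
  \<open>4 * (2 * N - 3 * k)\<close> labels.\<close>

lemma unbalanced_count:
  assumes x: "x \<subseteq> A" and i: "i \<in> A" "i \<notin> x" and j: "j \<in> A" "j \<notin> x" and ij: "i \<noteq> j"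
    and unb: "unbalanced x i j"
  shows "2 * Suc (card B) + 12 * k \<le> 8 * N"
proof -
  let ?F = "face x i j"
  define D where "D l = {w \<in> extremal. \<exists>u\<in>?F. w = toggle l u}" for l
  have finE: "finite extremal"
    using finite_B by (simp add: extremal_def)
  have finD: "finite (D l)" for l
    using finE by (simp add: D_def)
  have memF: "l \<in> u \<longleftrightarrow> l \<in> x" if "u \<in> ?F" "l \<noteq> i" "l \<noteq> j" for u l
    using that by (auto simp: face_def)
  \<comment> \<open>Apart from \<open>i\<close> and \<open>j\<close>, a member of \<open>D l\<close>
    differs from \<open>x\<close> exactly at \<open>l\<close>; hence the sets \<open>D l\<close> are
    disjoint from one another and from the face.\<close>
  have memD: "m \<in> w \<longleftrightarrow> (m \<in> x \<longleftrightarrow> m \<noteq> l)" if w: "w \<in> D l" and m: "m \<noteq> i" "m \<noteq> j" for w l m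
  proof -
    obtain u where "u \<in> ?F" "w = toggle l u"
      using w by (auto simp: D_def)
    then show ?thesis
      using memF[of u m] m by (auto simp: toggle_def)
  qed
  have card_D: "2 \<le> card (D l)" if l: "l \<in> A - {i, j}" for l
  proof -
    obtain u v where uv: "u \<in> ?F" "v \<in> ?F" "u \<noteq> v" "toggle l u \<in> extremal" "toggle l v \<in> extremal"
      using extremal_neighbours[OF x i j ij unb, of l] l by blast
    then have "toggle l u \<noteq> toggle l v"
      by (metis toggle_toggle)
    then have "2 = card {toggle l u, toggle l v}"
      by simp
    also have "\<dots> \<le> card (D l)"
      using uv finD by (intro card_mono) (auto simp: D_def)
    finally show ?thesis .
  qed
  have cardF: "card ?F = 4"
  proof -
    have "x \<noteq> insert i x" "x \<noteq> insert j x" "x \<noteq> insert i (insert j x)" "insert i x \<noteq> insert j x"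
      "insert i x \<noteq> insert i (insert j x)" "insert j x \<noteq> insert i (insert j x)"
      using i j ij by (metis insert_iff)+
    then show ?thesis
      by (simp add: face_def)
  qed
  have finA: "finite (A - {i, j})"
    using finite_B by simp
  have cA: "card (A - {i, j}) + 2 = Suc (card B)"
  proof -
    have "card {i, j} \<le> card A" "card (A - {i, j}) = card A - card {i, j}"
      using i j finite_B by (auto intro!: card_mono card_Diff_subset)
    then show ?thesis
      using ij finite_B a_notin by simp
  qed
  have "2 * card (A - {i, j}) \<le> (\<Sum>l\<in>A - {i, j}. card (D l))"
    using sum_mono[of "A - {i, j}" "\<lambda>_. 2" "\<lambda>l. card (D l)"] card_D by simp
  also have "\<dots> = card (\<Union>l\<in>A - {i, j}. D l)"
  proof (rule card_UN_disjoint[symmetric, OF finA])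
    show "\<forall>l\<in>A - {i, j}. \<forall>m\<in>A - {i, j}. l \<noteq> m \<longrightarrow> D l \<inter> D m = {}"
    proof (intro ballI impI)
      fix l m assume lm: "l \<in> A - {i, j}" "m \<in> A - {i, j}" "l \<noteq> m"
      have "w \<notin> D m" if w: "w \<in> D l" for w
        using memD[OF w, of l] memD[of w m l] lm by auto
      then show "D l \<inter> D m = {}"
        by blast
    qed
  qed (simp add: finD)
  finally have U: "2 * card (A - {i, j}) \<le> card (\<Union>l\<in>A - {i, j}. D l)" .
  have "?F \<inter> (\<Union>l\<in>A - {i, j}. D l) = {}"
  proof -
    have "w \<notin> D l" if "w \<in> ?F" "l \<in> A - {i, j}" for w l
      using memD[of w l l] memF[of w l] that by auto
    then show ?thesis
      by blast
  qed
  then have "card (?F \<union> (\<Union>l\<in>A - {i, j}. D l)) = 4 + card (\<Union>l\<in>A - {i, j}. D l)"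
    using finA finD cardF by (subst card_Un_disjoint) (auto simp: face_def)
  moreover have "?F \<union> (\<Union>l\<in>A - {i, j}. D l) \<subseteq> extremal"
    using unbalanced_extremal(1)[OF x i j ij unb] by (auto simp: D_def)
  then have "card (?F \<union> (\<Union>l\<in>A - {i, j}. D l)) \<le> card extremal"
    using finE card_mono by blast
  ultimately have "4 + 2 * card (A - {i, j}) \<le> card extremal"
    using U by (metis add_le_cancel_left order_trans)
  then have "2 * Suc (card B) \<le> card extremal"
    unfolding cA[symmetric] by simp
  moreover have "card extremal \<le> 4 * (2 * N - 3 * k)"
  proof -
    have "card extremal = card G"
      unfolding extremal_def by (rule card_labels_in) (auto simp: G_def)
    also have "\<dots> \<le> card {1..2 * N - 3 * k} + card {k + 1..2 * N - 2 * k}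
        + card {2 * k + 1..2 * N - k} + card {3 * k + 1..2 * N}"
      unfolding G_def by (meson add_le_mono1 card_Un_le order_trans)
    finally show ?thesis
      by simp
  qed
  ultimately show ?thesis
    using unbalanced_extremal(2)[OF x i j ij unb] by linarith
qed

lemma bound_if_not_unbalanced:
  assumes "\<And>x i j. x \<subseteq> A \<Longrightarrow> i \<in> A - x \<Longrightarrow> j \<in> A - x \<Longrightarrow> i \<noteq> j \<Longrightarrow> \<not> unbalanced x i j"
  shows "k + central_sum (card B) \<le> N"
proof -
  have "finite A"
    using finite_B by simp
  moreover have "\<theta> x j + \<theta> (insert j x) i = \<theta> x i + \<theta> (insert i x) j"
    if "x \<subseteq> A" "i \<in> A - x" "j \<in> A - x" "i \<noteq> j" for x i j
    using assms[OF that] by (simp add: unbalanced_def)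
  ultimately have "\<exists>h. \<forall>x\<subseteq>A. \<forall>i\<in>A - x. h (insert i x) = h x + \<theta> x i"
    by (rule potential_ex)
  then obtain h where h: "\<forall>x\<subseteq>A. \<forall>i\<in>A - x. h (insert i x) = h x + \<theta> x i"
    by (elim exE)
  show ?thesis
    by (rule balanced_bound[of h]) (use h in \<open>simp add: \<theta>_def\<close>)
qed

lemma bound_or_count:
  "k + central_sum (card B) \<le> N \<or> 2 * Suc (card B) + 12 * k \<le> 8 * N"
proof (cases "\<exists>x i j. x \<subseteq> A \<and> i \<in> A - x \<and> j \<in> A - x \<and> i \<noteq> j \<and> unbalanced x i j")
  case True
  then obtain x i j where "x \<subseteq> A" "i \<in> A - x" "j \<in> A - x" "i \<noteq> j" "unbalanced x i j"
    by metis
  then show ?thesis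
    using unbalanced_count[of x i j] by simp
next
  case False
  then show ?thesis
    by (intro disjI1 bound_if_not_unbalanced) metis
qed

end

section \<open>The case of dimension six\<close>

lemma diff_singleton_eq_imp: "u - {a} = v - {a} \<Longrightarrow> u = v \<or> u = toggle a v"
  by (auto simp: toggle_def split: if_splits)

context separated_numbering
begin

definition parity_window :: "bool \<Rightarrow> nat \<Rightarrow> nat set set" where
  "parity_window b \<tau> = {u \<in> window \<tau>. even (card u) = b}"

lemma finite_Pow_mem: "u \<in> Pow A \<Longrightarrow> finite u"
  using finite_B by (meson PowD finite.insertI finite_subset)

lemma finite_parity_window: "finite (parity_window b \<tau>)"
  using finite_B by (simp add: parity_window_def window_def)

text \<open>Window vertices of opposite parity with equal or adjacent projections would be equal,
  adjacent or two flips apart; the gap excludes adjacency and parity excludes the rest.\<close>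

lemma parity_window_bound:
  "card (nb B ((\<lambda>u. u - {a}) ` parity_window b \<tau>)) + card (parity_window (\<not> b) \<tau>) \<le> N"
proof -
  let ?p = "\<lambda>u. u - {a}"
  have sub: "?p ` parity_window b \<tau> \<subseteq> Pow B" for b
    by (auto simp: parity_window_def window_def)
  have "?p u \<notin> nb B (?p ` parity_window b \<tau>)" if u: "u \<in> parity_window (\<not> b) \<tau>" for u
  proof
    assume "?p u \<in> nb B (?p ` parity_window b \<tau>)"
    then consider v where "v \<in> parity_window b \<tau>" "?p u = ?p v"
      | v i where "v \<in> parity_window b \<tau>" "i \<in> B" "?p u = toggle i (?p v)"
      by (auto simp: nb_def)
    then show False
    proof cases
      case (1 v)
      then have "u = v"
        using u inj_onD[OF inj_on_window, of u v \<tau>] by (auto simp: parity_window_def)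
      then show False
        using 1 u by (auto simp: parity_window_def)
    next
      case (2 v i)
      have w: "v \<in> window \<tau>" "u \<in> window \<tau>" and par: "even (card u) \<noteq> even (card v)"
        using 2 u by (auto simp: parity_window_def)
      then have fin: "finite v" "finite (toggle i v)"
        using finite_Pow_mem[of v] by (auto simp: window_def toggle_def)
      have "?p u = ?p (toggle i v)"
        using 2 a_notin by (auto simp: toggle_def)
      then consider "u = toggle i v" | "u = toggle a (toggle i v)"
        using diff_singleton_eq_imp by blast
      then show False
      proof cases
        case 1
        then show False
          using window_no_edge[OF w(1), of i] w(2) 2 by auto
      next
        case 2
        then show False
          using par card_toggle_parity[OF fin(1), of i] card_toggle_parity[OF fin(2), of a] by auto
      qed
    qed
  qed
  then have "nb B (?p ` parity_window b \<tau>) \<inter> ?p ` parity_window (\<not> b) \<tau> = {}"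
    by auto
  then have "card (nb B (?p ` parity_window b \<tau>)) + card (?p ` parity_window (\<not> b) \<tau>)
      = card (nb B (?p ` parity_window b \<tau>) \<union> ?p ` parity_window (\<not> b) \<tau>)"
    using finite_nb[OF finite_B sub] finite_parity_window
    by (intro card_Un_disjoint[symmetric]) auto
  also have "\<dots> \<le> N"
    using nb_subset[OF sub] sub by (intro card_le_Pow[OF finite_B]) auto
  finally show ?thesis
    using card_image[OF inj_on_subset[OF inj_on_window], of "parity_window (\<not> b) \<tau>" \<tau>]
    by (simp add: parity_window_def)
qed

lemma card_parity_window_proj:
  "card ((\<lambda>u. u - {a}) ` parity_window b \<tau>) = card (parity_window b \<tau>)"
  by (rule card_image[OF inj_on_subset[OF inj_on_window[of \<tau>]]]) (auto simp: parity_window_def)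

lemma card_even_subsets: "card {x \<in> Pow A. even (card x)} = N"
proof -
  let ?S = "{x \<in> Pow A. even (card x)}"
  have ins: "card (insert a x) = Suc (card x)" if "x \<subseteq> B" for x
    using that finite_B a_notin by (meson card_insert_disjoint finite_subset subsetD)
  have "lower_section a ?S = {x \<in> Pow B. even (card x)}" "upper_section a ?S = {x \<in> Pow B. odd (card x)}"
    using a_notin by (auto simp: ins lower_section_def upper_section_def subset_insert)
  then have "card ?S = card {x \<in> Pow B. even (card x)} + card {x \<in> Pow B. odd (card x)}"
    using card_sections[of ?S a] finite_B by simp
  also have "\<dots> = card ({x \<in> Pow B. even (card x)} \<union> {x \<in> Pow B. odd (card x)})"
    using finite_B by (intro card_Un_disjoint[symmetric]) auto
  also have "{x \<in> Pow B. even (card x)} \<union> {x \<in> Pow B. odd (card x)} = Pow B"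
    by auto
  finally show ?thesis
    using finite_B by (simp add: card_Pow)
qed

text \<open>The value is 0 outside the range of labels, so sliding a window needs no range
  condition.\<close>

definition even_label :: "nat \<Rightarrow> nat" where
  "even_label l = (if l \<in> \<eta> ` {x \<in> Pow A. even (card x)} then 1 else 0)"

lemma even_label_eq: "x \<in> Pow A \<Longrightarrow> even_label (\<eta> x) = (if even (card x) then 1 else 0)"
proof -
  assume x: "x \<in> Pow A"
  have "\<eta> x \<in> \<eta> ` {y \<in> Pow A. even (card y)} \<longleftrightarrow> x \<in> {y \<in> Pow A. even (card y)}"
    using x by (intro inj_on_image_mem_iff[OF bij_betw_imp_inj_on[OF bij]]) auto
  then show ?thesis
    using x by (simp add: even_label_def)
qed

lemma sum_even_label_eq:
  "finite I \<Longrightarrow> (\<Sum>l\<in>I. even_label l) = card (I \<inter> \<eta> ` {x \<in> Pow A. even (card x)})"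
  unfolding even_label_def by (simp add: sum.If_cases)

lemma card_parity_window_eq_sum:
  "card (parity_window True \<tau>) = (\<Sum>l = \<tau>..<\<tau> + k. even_label l)"
proof -
  have "(\<Sum>l = \<tau>..<\<tau> + k. even_label l) = card ({\<tau>..<\<tau> + k} \<inter> \<eta> ` {x \<in> Pow A. even (card x)})"
    by (rule sum_even_label_eq) simp
  also have "{\<tau>..<\<tau> + k} \<inter> \<eta> ` {x \<in> Pow A. even (card x)} = \<eta> ` parity_window True \<tau>"
    by (auto simp: parity_window_def window_def)
  also have "card \<dots> = card (parity_window True \<tau>)"
    by (intro card_image inj_on_subset[OF bij_betw_imp_inj_on[OF bij]])
      (auto simp: parity_window_def window_def)
  finally show ?thesis
    by simp
qed

lemma sum_even_label: "(\<Sum>l = 1..<Suc (2 * N). even_label l) = N"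
proof -
  have "(\<Sum>l = 1..<Suc (2 * N). even_label l) = card ({1..<Suc (2 * N)} \<inter> \<eta> ` {x \<in> Pow A. even (card x)})"
    by (rule sum_even_label_eq) simp
  also have "{1..<Suc (2 * N)} \<inter> \<eta> ` {x \<in> Pow A. even (card x)} = \<eta> ` {x \<in> Pow A. even (card x)}"
    using label_bounds by (auto simp: less_Suc_eq_le)
  also have "card \<dots> = card {x \<in> Pow A. even (card x)}"
    by (intro card_image inj_on_subset[OF bij_betw_imp_inj_on[OF bij]]) auto
  finally show ?thesis
    using card_even_subsets by simp
qed

lemma card_parity_window_add:
  assumes "1 \<le> \<tau>" "\<tau> + k \<le> 2 * N + 1"
  shows "card (parity_window True \<tau>) + card (parity_window False \<tau>) = k"
proof -
  have "parity_window True \<tau> \<union> parity_window False \<tau> = window \<tau>"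
    "parity_window True \<tau> \<inter> parity_window False \<tau> = {}"
    by (auto simp: parity_window_def)
  then show ?thesis
    using card_Un_disjoint[OF finite_parity_window finite_parity_window, of True \<tau> False \<tau>]
      card_window[OF assms] by simp
qed

lemma parity_window_step:
  "even_label \<tau> + card (parity_window True (Suc \<tau>)) = card (parity_window True \<tau>) + even_label (\<tau> + k)"
proof -
  have "(\<Sum>l = \<tau>..<\<tau> + k. even_label l) = even_label \<tau> + (\<Sum>l = Suc \<tau>..<\<tau> + k. even_label l)"
    using k_pos by (intro sum.atLeast_Suc_lessThan) simp
  moreover have "(\<Sum>l = Suc \<tau>..<Suc \<tau> + k. even_label l)
      = (\<Sum>l = Suc \<tau>..<\<tau> + k. even_label l) + even_label (\<tau> + k)"
    using k_pos by simp
  ultimately show ?thesis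
    unfolding card_parity_window_eq_sum by simp
qed

end

text \<open>The initial segments of sizes 8 and 9 end at \<open>{0, 2}\<close> and
  \<open>{0, 3}\<close>; adding 4 leads to ranks 20 and 21. The ranks are computed by removing least
  coordinates one at a time.\<close>

lemma five_cube_nb:
  assumes S: "S \<subseteq> Pow {0, 1, 2, 3, 4}"
  shows "card S = 8 \<Longrightarrow> 21 \<le> card (nb {0, 1, 2, 3, 4} S)"
    and "card S = 9 \<Longrightarrow> 22 \<le> card (nb {0, 1, 2, 3, 4} S)"
proof -
  let ?B = "{0, 1, 2, 3, 4} :: nat set"
  have r0: "rank B {} = 0" if "finite B" for B
  proof -
    have "{z \<in> Pow B. prec z {}} = {}"
      using that by (auto simp: prec_def dest: finite_subset)
    then show ?thesis
      unfolding rank_def by (metis card.empty)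
  qed
  have ch: "(4::nat) choose Suc (Suc 0) = 6" "(3::nat) choose Suc (Suc 0) = 3"
    by (simp_all add: numeral_eq_Suc)
  note mins = rank_insert_min[of "{1, 2, 3, 4}" 0] rank_insert_min[of "{2, 3, 4}" 1]
    rank_insert_min[of "{3, 4}" 2] rank_insert_min[of "{4}" 3] rank_insert_min[of "{}" 4]
  have R4: "rank {4} {4} = 1"
    using mins(9)[of "{}"] by (simp add: r0 small_subsets_Suc)
  have R3: "rank {3, 4} {4} = 2" "rank {3, 4} {3} = 1" "rank {3, 4} {3, 4} = 3"
    using mins(8)[of "{4}"] mins(7)[of "{}"] mins(7)[of "{4}"] by (simp_all add: R4 r0 small_subsets_Suc)
  have R2: "rank {2, 3, 4} {2} = 1" "rank {2, 3, 4} {3} = 2"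
    "rank {2, 3, 4} {2, 4} = 5" "rank {2, 3, 4} {3, 4} = 6"
    using mins(5)[of "{}"] mins(6)[of "{3}"] mins(5)[of "{4}"] mins(6)[of "{3, 4}"]
    by (simp_all add: R3 r0 small_subsets_Suc)
  have R1: "rank {1, 2, 3, 4} {2} = 2" "rank {1, 2, 3, 4} {3} = 3"
    "rank {1, 2, 3, 4} {2, 4} = 9" "rank {1, 2, 3, 4} {3, 4} = 10"
    using mins(4)[of "{2}"] mins(4)[of "{3}"] mins(4)[of "{2, 4}"] mins(4)[of "{3, 4}"]
    by (simp_all add: R2 small_subsets_Suc)
  have R0: "rank ?B {0, 2} = 7" "rank ?B {0, 3} = 8" "rank ?B {0, 2, 4} = 20" "rank ?B {0, 3, 4} = 21"
    using mins(1)[of "{2}"] mins(1)[of "{3}"] mins(1)[of "{2, 4}"] mins(1)[of "{3, 4}"]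
    by (simp_all add: R1[unfolded One_nat_def] small_subsets_Suc ch)
  show "21 \<le> card (nb ?B S)" if "card S = 8"
    using card_nb_ge_rank[of ?B "{0, 2}" 4 S] S that R0 by (simp add: insert_commute)
  show "22 \<le> card (nb ?B S)" if "card S = 9"
    using card_nb_ge_rank[of ?B "{0, 3}" 4 S] S that R0 by (simp add: insert_commute)
qed

lemma central_sum_values:
  "central_sum 1 = 1" "central_sum 2 = 2" "central_sum 3 = 4" "central_sum 4 = 7"
  "central_sum 5 = 13" "central_sum 6 = 23" "central_sum 7 = 43"
  by code_simp+

text \<open>The number of even vertices in a window of 20 labels changes by at most one from one window to
  the next and avoids 8, 9, 11 and 12, so it is always 10.\<close>

lemma (in separated_numbering) five_cube_impossible:
  assumes B: "B = {0, 1, 2, 3, 4}" and k: "k = 20"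
  shows False
proof -
  have cB: "card B = 5" and N: "N = 32"
    using B by auto
  define e where "e \<tau> = card (parity_window True \<tau>)" for \<tau>
  define f where "f \<tau> = card (parity_window False \<tau>)" for \<tau>
  have ef: "e \<tau> + f \<tau> = 20" if "1 \<le> \<tau>" "\<tau> \<le> 45" for \<tau>
    using card_parity_window_add[of \<tau>] that N k by (simp add: e_def f_def)
  have gap: "card (parity_window b \<tau>) = 8 \<Longrightarrow> card (parity_window (\<not> b) \<tau>) \<le> 11"
    "card (parity_window b \<tau>) = 9 \<Longrightarrow> card (parity_window (\<not> b) \<tau>) \<le> 10" for b \<tau>
  proof -
    let ?S = "(\<lambda>u. u - {a}) ` parity_window b \<tau>"
    have "?S \<subseteq> Pow B"
      by (auto simp: parity_window_def window_def)
    then have S: "?S \<subseteq> Pow {0, 1, 2, 3, 4}"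
      unfolding B .
    have bd: "card (nb {0, 1, 2, 3, 4} ?S) + card (parity_window (\<not> b) \<tau>) \<le> 32"
      using parity_window_bound[of b \<tau>] N B by simp
    show "card (parity_window b \<tau>) = 8 \<Longrightarrow> card (parity_window (\<not> b) \<tau>) \<le> 11"
      using five_cube_nb(1)[OF S] bd card_parity_window_proj[of b \<tau>] by simp
    show "card (parity_window b \<tau>) = 9 \<Longrightarrow> card (parity_window (\<not> b) \<tau>) \<le> 10"
      using five_cube_nb(2)[OF S] bd card_parity_window_proj[of b \<tau>] by simp
  qed
  \<comment> \<open>Counts 8 and 9 would leave 12 and 11 vertices of the other parity, more than
    \<open>gap\<close> permits; 12 and 11 are excluded by exchanging the parities.\<close>
  have avoid: "e \<tau> \<noteq> 8" "e \<tau> \<noteq> 9" "e \<tau> \<noteq> 11" "e \<tau> \<noteq> 12" if "1 \<le> \<tau>" "\<tau> \<le> 45" for \<tau>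
    using ef[OF that] gap[of True \<tau>] gap[of False \<tau>] by (auto simp: e_def f_def)
  have chi: "even_label l \<le> 1" for l
    by (simp add: even_label_def)
  have step: "even_label \<tau> + e (Suc \<tau>) = e \<tau> + even_label (\<tau> + 20)" for \<tau>
    using parity_window_step[of \<tau>] k by (simp add: e_def)
  have step': "e (Suc \<tau>) \<le> Suc (e \<tau>)" "e \<tau> \<le> Suc (e (Suc \<tau>))" for \<tau>
    using step[of \<tau>] chi[of \<tau>] chi[of "\<tau> + 20"] by linarith+
  have low: "e \<tau> \<le> 7" if "e 1 \<le> 7" "1 \<le> \<tau>" "\<tau> \<le> 45" for \<tau>
    using that(2,3)
  proof (induction \<tau> rule: dec_induct)
    case (step \<tau>)
    then show ?case
      using step'[of \<tau>] avoid[of "Suc \<tau>"] by auto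
  qed (use that in simp)
  have high: "e \<tau> \<ge> 13" if "e 1 \<ge> 13" "1 \<le> \<tau>" "\<tau> \<le> 45" for \<tau>
    using that(2,3)
  proof (induction \<tau> rule: dec_induct)
    case (step \<tau>)
    then show ?case
      using step'[of \<tau>] avoid[of "Suc \<tau>"] by auto
  qed (use that in simp)
  have mid: "e \<tau> = 10" if "e 1 = 10" "1 \<le> \<tau>" "\<tau> \<le> 45" for \<tau>
    using that(2,3)
  proof (induction \<tau> rule: dec_induct)
    case (step \<tau>)
    then show ?case
      using step'[of \<tau>] avoid[of "Suc \<tau>"] by auto
  qed (use that in simp)
  have eS: "e \<tau> = (\<Sum>l = \<tau>..<\<tau> + 20. even_label l)" for \<tau>
    using card_parity_window_eq_sum[of \<tau>] k by (simp add: e_def)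
  \<comment> \<open>The 64 labels form three disjoint windows and four further labels, so the three
    counts sum to between 28 and 32. They are neither all at most 7 nor all at least 13.\<close>
  have "(\<Sum>l = 1..<65. even_label l) = 32"
    using sum_even_label N by simp
  moreover have "(\<Sum>l = 1..<65. even_label l) = (\<Sum>l = 1..<21. even_label l)
      + (\<Sum>l = 21..<41. even_label l) + (\<Sum>l = 41..<61. even_label l) + (\<Sum>l = 61..<65. even_label l)"
    by (simp add: sum.atLeastLessThan_concat)
  moreover have "(\<Sum>l = 61..<65. even_label l) \<le> 4"
    using sum_bounded_above[of "{61..<65}" even_label 1] chi by simp
  ultimately have tot: "e 1 + e 21 + e 41 \<le> 32" "28 \<le> e 1 + e 21 + e 41"
    using eS[of 1] eS[of 21] eS[of 41] by simp_all
  have "e 1 = 10"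
  proof -
    have "\<not> e 1 \<le> 7"
      using low[of 1] low[of 21] low[of 41] tot by auto
    moreover have "\<not> 13 \<le> e 1"
      using high[of 1] high[of 21] high[of 41] tot by auto
    ultimately show ?thesis
      using avoid[of 1] by auto
  qed
  \<comment> \<open>Constant window counts give period 20. Adjacent vertices have opposite parity,
    so no edge has gap exactly 20.\<close>
  then have per: "even_label \<tau> = even_label (\<tau> + 20)" if "1 \<le> \<tau>" "\<tau> \<le> 44" for \<tau>
    using step[of \<tau>] mid[of \<tau>] mid[of "Suc \<tau>"] that by simp
  have no20: "\<eta> y \<noteq> \<eta> x + 20" if "x \<in> Pow A" "y \<in> Pow A" "even (card x) \<noteq> even (card y)" for x y
  proof
    assume "\<eta> y = \<eta> x + 20"
    then have "even_label (\<eta> x) = even_label (\<eta> y)"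
      using per[of "\<eta> x"] label_bounds[OF that(1)] label_bounds[OF that(2)] N by simp
    then show False
      using even_label_eq[OF that(1)] even_label_eq[OF that(2)] that(3) by (simp split: if_splits)
  qed
  interpret strict: separated_numbering B a \<eta> 21
  proof
    fix x i assume x: "x \<in> Pow A" and i: "i \<in> A"
    have y: "toggle i x \<in> Pow A"
      by (rule toggle_in_Pow[OF x i])
    have "even (card x) \<noteq> even (card (toggle i x))"
      using card_toggle_parity[OF finite_Pow_mem[OF x], of i] by simp
    then show "\<eta> x + 21 \<le> \<eta> (toggle i x) \<or> \<eta> (toggle i x) + 21 \<le> \<eta> x"
      using sep[OF x i] no20[OF x y] no20[OF y x] k by linarith
  qed (use finite_B a_notin bij in auto)
  \<comment> \<open>With gap 21 both alternatives fail: \<open>21 + 13 > 32\<close> and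
    \<open>2 * 6 + 12 * 21 > 8 * 32\<close>.\<close>
  show False
    using strict.bound_or_count cB by (simp add: central_sum_values)
qed

section \<open>The bound in all dimensions\<close>

lemma central_binomial_step: "Suc d choose (Suc d div 2) \<le> 2 * (d choose (d div 2))"
proof (cases "Suc d div 2")
  case (Suc r)
  have "Suc d choose Suc r = (d choose r) + (d choose Suc r)"
    by simp
  then show ?thesis
    using Suc binomial_maximum[of d r] binomial_maximum[of d "Suc r"] by simp
qed simp

lemma three_central_binomial_le:
  assumes "7 \<le> d"
  shows "3 * (d choose (d div 2)) \<le> 2 ^ d"
  using assms
proof (induction d rule: dec_induct)
  case base
  show ?case
    by code_simp
next
  case (step d)
  then show ?case
    using central_binomial_step[of d] by simp
qed

text \<open>With \<open>k > 2 ^ d - central_sum d\<close> this gives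
  \<open>12 * k \<ge> 8 * 2 ^ d\<close>, which contradicts the count of extremal labels.\<close>

lemma three_central_sum_le:
  assumes "7 \<le> d"
  shows "3 * central_sum d \<le> 2 ^ d + 3"
  using assms
proof (induction d rule: dec_induct)
  case base
  show ?case
    by (simp add: central_sum_values)
next
  case (step d)
  then show ?case
    using three_central_binomial_le[of d] by simp
qed

lemma separated_numbering_bound:
  assumes "separated_numbering {..<d} d \<eta> k"
  shows "k + central_sum d \<le> 2 ^ d"
proof (rule ccontr)
  interpret separated_numbering "{..<d}" d \<eta> k
    by fact
  assume "\<not> ?thesis"
  then have k: "2 ^ d < k + central_sum d"
    by simp
  then have cnt: "2 * d + 2 + 12 * k \<le> 8 * 2 ^ d"
    using bound_or_count by simp
  consider "d = 0" | "d = 1" | "d = 2" | "d = 3" | "d = 4" | "d = 5" | "d = 6" | "7 \<le> d"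
    by linarith
  then show False
  proof cases
    \<comment> \<open>Here \<open>d = 5\<close>: \<open>k + 13 > 32\<close> gives
      \<open>k \<ge> 20\<close> and \<open>12 + 12 * k \<le> 256\<close> gives
      \<open>k \<le> 20\<close>, so the count alone is not decisive.\<close>
    case 6
    then have "k = 20"
      using cnt k by (simp add: central_sum_values)
    moreover have "{..<d} = {0, 1, 2, 3, 4}"
      using 6 by auto
    ultimately show False
      using five_cube_impossible by blast
  next
    case 8
    then show False
      using three_central_sum_le[OF 8] cnt k by linarith
  qed (use cnt k central_sum_values in simp_all)
qed

section \<open>Transfer to bit strings\<close>

definition to_set :: "bool list \<Rightarrow> nat set" where
  "to_set xs = {i. i < length xs \<and> xs ! i}"

definition of_set :: "nat \<Rightarrow> nat set \<Rightarrow> bool list" where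
  "of_set n x = map (\<lambda>i. i \<in> x) [0..<n]"

lemma to_set_of_set: "x \<in> Pow {..<n} \<Longrightarrow> to_set (of_set n x) = x"
  by (auto simp: to_set_def of_set_def)

lemma of_set_to_set: "xs \<in> cube_vertices n \<Longrightarrow> of_set n (to_set xs) = xs"
  by (auto simp: to_set_def of_set_def cube_vertices_def intro!: nth_equalityI)

lemma to_set_in: "xs \<in> cube_vertices n \<Longrightarrow> to_set xs \<in> Pow {..<n}"
  by (auto simp: to_set_def cube_vertices_def)

lemma of_set_in: "of_set n x \<in> cube_vertices n"
  by (simp add: of_set_def cube_vertices_def)

lemma bij_to_set: "bij_betw to_set (cube_vertices n) (Pow {..<n})"
  by (rule bij_betw_byWitness[of _ "of_set n"]) (auto simp: of_set_to_set to_set_of_set of_set_in dest: to_set_in)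

lemma bij_of_set: "bij_betw (of_set n) (Pow {..<n}) (cube_vertices n)"
  by (rule bij_betw_byWitness[of _ to_set]) (auto simp: of_set_to_set to_set_of_set of_set_in dest: to_set_in)

lemma card_cube_vertices: "card (cube_vertices n) = 2 ^ n"
  using bij_betw_same_card[OF bij_to_set, of n] by (simp add: card_Pow)

lemma finite_cube_vertices: "finite (cube_vertices n)"
  using bij_betw_finite[OF bij_to_set, of n] by simp

lemma cube_adj_iff:
  assumes xs: "xs \<in> cube_vertices n" and ys: "ys \<in> cube_vertices n"
  shows "cube_adj xs ys \<longleftrightarrow> (\<exists>i<n. to_set ys = toggle i (to_set xs))"
proof -
  have len: "length xs = n" "length ys = n"
    using xs ys by (auto simp: cube_vertices_def)
  have "cube_adj xs ys \<longleftrightarrow> (\<exists>i. {i. i < n \<and> xs ! i \<noteq> ys ! i} = {i})"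
    using len by (simp add: cube_adj_def card_1_singleton_iff)
  also have "\<dots> \<longleftrightarrow> (\<exists>i<n. to_set ys = toggle i (to_set xs))"
  proof (intro iffI; elim exE conjE)
    fix i assume i: "{i. i < n \<and> xs ! i \<noteq> ys ! i} = {i}"
    then have "i < n" "xs ! i \<noteq> ys ! i"
      by auto
    moreover have "xs ! j = ys ! j" if "j < n" "j \<noteq> i" for j
      using i that by auto
    ultimately have "to_set ys = toggle i (to_set xs)"
      using len by (auto simp: to_set_def toggle_def)
    then show "\<exists>i<n. to_set ys = toggle i (to_set xs)"
      using \<open>i < n\<close> by blast
  next
    fix i assume i: "i < n" "to_set ys = toggle i (to_set xs)"
    have "ys ! j \<longleftrightarrow> (xs ! j \<longleftrightarrow> j \<noteq> i)" if "j < n" for j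
    proof -
      have "j \<in> to_set ys \<longleftrightarrow> (j \<in> to_set xs \<longleftrightarrow> j \<noteq> i)"
        unfolding i(2) by (auto simp: toggle_def)
      then show ?thesis
        using that len by (simp add: to_set_def)
    qed
    then have "{j. j < n \<and> xs ! j \<noteq> ys ! j} = {i}"
      using i(1) by auto
    then show "\<exists>i. {i. i < n \<and> xs ! i \<noteq> ys ! i} = {i}"
      by blast
  qed
  finally show ?thesis .
qed

section \<open>Edge gaps of numberings of bit strings\<close>

definition edge_gaps :: "nat \<Rightarrow> (bool list \<Rightarrow> nat) \<Rightarrow> int set" where
  "edge_gaps n \<eta> = {\<bar>int (\<eta> v) - int (\<eta> w)\<bar> | v w. v \<in> cube_vertices n \<and> w \<in> cube_vertices n \<and> cube_adj v w}"

lemma min_edge_gap_cube: "min_edge_gap (cube_vertices n) cube_adj \<eta> = Min (edge_gaps n \<eta>)"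
  by (simp add: min_edge_gap_def edge_gaps_def)

lemma finite_edge_gaps: "finite (edge_gaps n \<eta>)"
proof (rule finite_subset)
  show "edge_gaps n \<eta> \<subseteq> (\<lambda>(v, w). \<bar>int (\<eta> v) - int (\<eta> w)\<bar>) ` (cube_vertices n \<times> cube_vertices n)"
    by (auto simp: edge_gaps_def)
qed (simp add: finite_cube_vertices)

lemma edge_gaps_nonempty:
  assumes "n \<ge> 1"
  shows "edge_gaps n \<eta> \<noteq> {}"
proof -
  have "cube_adj (of_set n {}) (of_set n {0})"
    using assms by (subst cube_adj_iff[of _ n]) (auto simp: of_set_in to_set_of_set toggle_def)
  then have "\<bar>int (\<eta> (of_set n {})) - int (\<eta> (of_set n {0}))\<bar> \<in> edge_gaps n \<eta>"
    unfolding edge_gaps_def using of_set_in by blast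
  then show ?thesis
    by blast
qed

text \<open>The last coordinate \<open>d\<close> serves as the direction of projection.\<close>

lemma numbering_separated:
  assumes num: "numbering (cube_vertices (Suc d)) \<eta>" and k: "0 < k"
    and gap: "\<And>g. g \<in> edge_gaps (Suc d) \<eta> \<Longrightarrow> int k \<le> g"
  shows "separated_numbering {..<d} d (\<lambda>x. \<eta> (of_set (Suc d) x)) k"
proof
  have ins: "insert d {..<d} = {..<Suc d}"
    by auto
  have "bij_betw \<eta> (cube_vertices (Suc d)) {1..2 ^ Suc d}"
    using num by (simp add: numbering_def card_cube_vertices)
  from bij_betw_trans[OF bij_of_set this]
  show "bij_betw (\<lambda>x. \<eta> (of_set (Suc d) x)) (Pow (insert d {..<d})) {1..2 * 2 ^ card {..<d}}"
    by (simp add: comp_def ins)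
  fix x i assume "x \<in> Pow (insert d {..<d})" "i \<in> insert d {..<d}"
  then have x: "x \<in> Pow {..<Suc d}" and i: "i \<in> {..<Suc d}"
    by (simp_all only: ins)
  have y: "toggle i x \<in> Pow {..<Suc d}"
    by (rule toggle_in_Pow[OF x i])
  have "cube_adj (of_set (Suc d) x) (of_set (Suc d) (toggle i x))"
    using i by (subst cube_adj_iff[of _ "Suc d"]) (auto simp only: of_set_in to_set_of_set[OF x] to_set_of_set[OF y] lessThan_iff)
  then have "\<bar>int (\<eta> (of_set (Suc d) x)) - int (\<eta> (of_set (Suc d) (toggle i x)))\<bar> \<in> edge_gaps (Suc d) \<eta>"
    unfolding edge_gaps_def using of_set_in by blast
  from gap[OF this] show "\<eta> (of_set (Suc d) x) + k \<le> \<eta> (of_set (Suc d) (toggle i x)) \<or>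
      \<eta> (of_set (Suc d) (toggle i x)) + k \<le> \<eta> (of_set (Suc d) x)"
    by linarith
qed (use k in auto)

lemma min_edge_gap_le:
  assumes num: "numbering (cube_vertices (Suc d)) \<eta>"
  shows "min_edge_gap (cube_vertices (Suc d)) cube_adj \<eta> \<le> 2 ^ d - int (central_sum d)"
proof -
  define g where "g = Min (edge_gaps (Suc d) \<eta>)"
  have le: "g \<le> g'" if "g' \<in> edge_gaps (Suc d) \<eta>" for g'
    using that finite_edge_gaps by (simp add: g_def)
  \<comment> \<open>The bound is nonnegative, which settles a minimal gap that is not positive; the
    locale covers positive gaps only.\<close>
  have "int (central_sum d) \<le> 2 ^ d"
    using central_sum_le[of d] by (metis of_nat_le_iff of_nat_numeral of_nat_power)
  moreover have "g \<le> 2 ^ d - int (central_sum d)" if "0 < g"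
  proof -
    have "separated_numbering {..<d} d (\<lambda>x. \<eta> (of_set (Suc d) x)) (nat g)"
      using that le by (intro numbering_separated[OF num]) auto
    from separated_numbering_bound[OF this] have "int (nat g + central_sum d) \<le> int (2 ^ d)"
      by (simp only: of_nat_le_iff)
    then show ?thesis
      using that by simp
  qed
  ultimately show ?thesis
    unfolding min_edge_gap_cube g_def[symmetric] by linarith
qed

lemma numbering_min_edge_gap_ge:
  "\<exists>\<eta>. numbering (cube_vertices (Suc d)) \<eta> \<and>
    2 ^ d - int (central_sum d) \<le> min_edge_gap (cube_vertices (Suc d)) cube_adj \<eta>"
proof -
  have ins: "insert d {..<d} = {..<Suc d}"
    by auto
  obtain \<eta> where bij: "bij_betw \<eta> (Pow {..<Suc d}) {1..2 ^ Suc d}"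
    and sep: "\<forall>x\<in>Pow {..<Suc d}. \<forall>i\<in>{..<Suc d}. \<eta> x + (2 ^ d - central_sum d) \<le> \<eta> (toggle i x) \<or>
      \<eta> (toggle i x) + (2 ^ d - central_sum d) \<le> \<eta> x"
    using separated_numbering_ex[of "{..<d}" d] unfolding ins by (auto simp: card_lessThan)
  \<comment> \<open>By \<open>central_sum_le\<close> the subtraction of natural numbers is not
    truncated.\<close>
  have "int (2 ^ d - central_sum d) = 2 ^ d - int (central_sum d)"
    using central_sum_le[of d] by (simp add: of_nat_diff)
  moreover have "int (2 ^ d - central_sum d) \<le> Min (edge_gaps (Suc d) (\<lambda>xs. \<eta> (to_set xs)))"
  proof (rule Min.boundedI)
    fix g assume "g \<in> edge_gaps (Suc d) (\<lambda>xs. \<eta> (to_set xs))"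
    then obtain v w where vw: "v \<in> cube_vertices (Suc d)" "w \<in> cube_vertices (Suc d)" "cube_adj v w"
      and g: "g = \<bar>int (\<eta> (to_set v)) - int (\<eta> (to_set w))\<bar>"
      by (auto simp: edge_gaps_def)
    obtain i where i: "i \<in> {..<Suc d}" "to_set w = toggle i (to_set v)"
      using cube_adj_iff[OF vw(1,2)] vw(3) by auto
    show "int (2 ^ d - central_sum d) \<le> g"
      using sep[rule_format, OF to_set_in[OF vw(1)] i(1)] unfolding g i(2) by linarith
  qed (simp_all add: finite_edge_gaps edge_gaps_nonempty)
  moreover have "numbering (cube_vertices (Suc d)) (\<lambda>xs. \<eta> (to_set xs))"
    using bij_betw_trans[OF bij_to_set bij] by (simp add: numbering_def card_cube_vertices comp_def)
  ultimately show ?thesis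
    unfolding min_edge_gap_cube by (intro exI[of _ "\<lambda>xs. \<eta> (to_set xs)"]) simp
qed

theorem theorem3:
  fixes n :: nat
  assumes "n \<ge> 1"
  shows "antibandwidth (cube_vertices n) cube_adj =
           2 ^ (n - 1) - (\<Sum>m = 0..<n - 1. int (m choose (m div 2)))"
proof -
  obtain d where n: "n = Suc d"
    using assms by (cases n) auto
  let ?V = "cube_vertices (Suc d)" and ?M = "2 ^ d - int (central_sum d)"
  have "antibandwidth ?V cube_adj = ?M"
    unfolding antibandwidth_def
  proof (rule Max_eqI)
    \<comment> \<open>Values outside the cube are arbitrary, so there are infinitely many
      numberings; finiteness of the set of minimal gaps comes from bounding its elements.\<close>
    have "0 \<le> min_edge_gap ?V cube_adj \<eta>" for \<eta>
      unfolding min_edge_gap_cube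
      by (rule Min.boundedI) (auto simp: finite_edge_gaps edge_gaps_nonempty, auto simp: edge_gaps_def)
    then have "{min_edge_gap ?V cube_adj \<eta> | \<eta>. numbering ?V \<eta>} \<subseteq> {0..?M}"
      using min_edge_gap_le by auto
    then show "finite {min_edge_gap ?V cube_adj \<eta> | \<eta>. numbering ?V \<eta>}"
      using finite_subset by blast
    show "?M \<in> {min_edge_gap ?V cube_adj \<eta> | \<eta>. numbering ?V \<eta>}"
      using numbering_min_edge_gap_ge[of d] min_edge_gap_le by (force intro: antisym)
  qed (use min_edge_gap_le in auto)
  then show ?thesis
    by (simp add: n central_sum_def lessThan_atLeast0)
qed

end
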